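(* Let $p\ge 1$, let $L,U$ be $\mathbb F$-adapted càdlàg processes on $[0,T]$ with $L_t\le U_t$ for $t\in[0,T]$, and let $X\in\underline H^p$ be such that $L_t\le X_t\le U_t$ for $t\in[0,T]$. If $p>1$, then $$\|L^+\|_{\mathcal S^p}+\|U^-\|_{\mathcal S^p}+[Var_p(L,U)]^{1/p}\le \max(2,p)\,\|X\|_{\underline H^p},$$ while for $p=1$, $$\|L^+\|_{\mathcal D^1}+\|U^-\|_{\mathcal D^1}+Var_1(L,U)\le 2\|X\|_{\underline H^1}.$$
   Context: Let $(\Omega,\mathcal F,\mathbb F=(\mathcal F_t),\mathbb P)$ be a filtered probability space satisfying the usual conditions, and fix $T>0$. $\mathcal T$ denotes the set of stopping times with values in $[0,T]$. Write $x^+=\max(x,0)$, $x^-=\max(-x,0)$. For $p>1$, $\mathcal S^p$ is the space of càdlàg $\mathbb F$-adapted processes $X$ with $\|X\|_{\mathcal S^p}:=(\mathbb E\sup_{t\le T}|X_t|^p)^{1/p}<\infty$. $\mathcal D^1$ is the space of càdlàg $\mathbb F$-adapted processes $X$ of class (D) (i.e. $\{X_\tau:\tau\in\mathcal T\}$ is uniformly integrable) with norm $\|X\|_{\mathcal D^1}:=\sup_{\tau\in\mathcal T}\mathbb E|X_\tau|$. For a finite-variation adapted càdlàg process $V$ with Jordan decomposition $V=V^+-V^-$, $|V|_t:=V^+_t+V^-_t$. The canonical decomposition of a càdlàg semimartingale $X$ is $X=X_0+A+M$ with $A$ a predictable càdlàg finite-variation process, $A_0=0$, and $M$ a local martingale,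 $M_0=0$. $\underline H^p$ is the space of càdlàg semimartingales $X$ admitting a canonical decomposition and with finite norm $$\|X\|_{\underline H^p}:=\|X\|_{\mathcal S^p}+(\mathbb E|A|_T^p)^{1/p}\ (p>1),\qquad \|X\|_{\underline H^1}:=\|X\|_{\mathcal D^1}+\mathbb E|A|_T\ (p=1),$$ where for $p=1$ it is required that $X\in\mathcal D^1$. For $p\ge1$ the mean co-variation of $L\le U$ is $$Var_p(L,U):=\sup_\pi\mathbb E\left(\sum_{i=0}^{n-1}\left\{\left[\mathbb E(L_{\tau_{i+1}}-U_{\tau_i}\mid\mathcal F_{\tau_i})\right]^++\left[\mathbb E(U_{\tau_{i+1}}-L_{\tau_i}\mid\mathcal F_{\tau_i})\right]^-\right\}\right)^p,$$ with the supremum over all finite random partitions $\pi=\{0=\tau_0\le\tau_1\le\dots\le\tau_n=T\}$ consisting of stopping times. The conditional expectations are understood as extended-real-valued random variables, well defined whenever $(L_{\tau_{i+1}}-U_{\tau_i})^+$ and $(U_{\tau_{i+1}}-L_{\tau_i})^-$ are integrable (which is the case when some $X\in\underline H^p$ lies between $L$ and $U$). *)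

theory Defs
  imports "HOL-Probability.Probability"
begin

text \<open>
  Time is indexed by \<open>real\<close>, as the library's \<open>filtration\<close> locale needs a linear order on the whole
  index type. The \<open>\<sigma>\<close>-algebras at negative times play no role: a filtration
  on \<open>[0,\<infinity>)\<close> extends by \<open>F 0\<close>. Likewise only the values \<open>X t \<omega>\<close> of a
  process at \<open>t \<in> [0,T]\<close> matter. Path regularity is required for every \<open>\<omega>\<close>, while
  identities and inequalities between processes are required for almost every \<open>\<omega>\<close>,
  simultaneously for all times.
\<close>

locale usual_filtered_prob_space =
  prob_space M + complete_measure M + filtration "space M" F
  for M :: "'a measure" and F :: "real \<Rightarrow> 'a measure" +
  assumes sets_F_subset: "sets (F t) \<subseteq> sets M"
    and null_sets_F0: "null_sets M \<subseteq> sets (F 0)"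
    and right_continuous: "0 \<le> t \<Longrightarrow> sets (F t) = (\<Inter>s\<in>{t<..}. sets (F s))"

definition stopping_times :: "'a measure \<Rightarrow> (real \<Rightarrow> 'a measure) \<Rightarrow> real \<Rightarrow> ('a \<Rightarrow> real) set" where
  "stopping_times M F T = {\<tau>. stopping_time F \<tau> \<and> (\<forall>\<omega>\<in>space M. \<tau> \<omega> \<in> {0..T})}"

definition cadlag_on :: "real \<Rightarrow> (real \<Rightarrow> real) \<Rightarrow> bool" where
  "cadlag_on T f \<longleftrightarrow>
     (\<forall>t\<in>{0..<T}. continuous (at_right t) f) \<and> (\<forall>t\<in>{0<..T}. \<exists>l. (f \<longlongrightarrow> l) (at_left t))"

definition cadlag_adapted ::
    "'a measure \<Rightarrow> (real \<Rightarrow> 'a measure) \<Rightarrow> real \<Rightarrow> (real \<Rightarrow> 'a \<Rightarrow> real) \<Rightarrow> bool" where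
  "cadlag_adapted M F T X \<longleftrightarrow>
     (\<forall>t\<in>{0..T}. X t \<in> borel_measurable (F t)) \<and> (\<forall>\<omega>\<in>space M. cadlag_on T (\<lambda>t. X t \<omega>))"

text \<open>Powers \<open>x\<^sup>p\<close> of extended nonnegative reals, for exponents \<open>p > 0\<close>.\<close>

definition epowr :: "ennreal \<Rightarrow> real \<Rightarrow> ennreal" where
  "epowr x p = (if x = \<infinity> then \<infinity> else ennreal (enn2real x powr p))"


subsection \<open>The spaces \<open>S\<^sup>p\<close> and \<open>D\<^sup>1\<close>\<close>

definition Sp_norm :: "'a measure \<Rightarrow> real \<Rightarrow> real \<Rightarrow> (real \<Rightarrow> 'a \<Rightarrow> real) \<Rightarrow> ennreal" where
  "Sp_norm M T p X = epowr (\<integral>\<^sup>+\<omega>. (SUP t\<in>{0..T}. epowr (ennreal \<bar>X t \<omega>\<bar>) p) \<partial>M) (1 / p)"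

definition D1_norm ::
    "'a measure \<Rightarrow> (real \<Rightarrow> 'a measure) \<Rightarrow> real \<Rightarrow> (real \<Rightarrow> 'a \<Rightarrow> real) \<Rightarrow> ennreal" where
  "D1_norm M F T X = (SUP \<tau>\<in>stopping_times M F T. \<integral>\<^sup>+\<omega>. ennreal \<bar>X (\<tau> \<omega>) \<omega>\<bar> \<partial>M)"

definition uniformly_integrable :: "'a measure \<Rightarrow> ('a \<Rightarrow> real) set \<Rightarrow> bool" where
  "uniformly_integrable M \<Y> \<longleftrightarrow>
     \<Y> \<subseteq> borel_measurable M \<and>
     ((\<lambda>c. SUP Y\<in>\<Y>. \<integral>\<^sup>+\<omega>\<in>{\<omega>. c < \<bar>Y \<omega>\<bar>}. ennreal \<bar>Y \<omega>\<bar> \<partial>M) \<longlongrightarrow> 0) at_top"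

definition class_D ::
    "'a measure \<Rightarrow> (real \<Rightarrow> 'a measure) \<Rightarrow> real \<Rightarrow> (real \<Rightarrow> 'a \<Rightarrow> real) \<Rightarrow> bool" where
  "class_D M F T X \<longleftrightarrow> uniformly_integrable M ((\<lambda>\<tau> \<omega>. X (\<tau> \<omega>) \<omega>) ` stopping_times M F T)"

definition D1_space ::
    "'a measure \<Rightarrow> (real \<Rightarrow> 'a measure) \<Rightarrow> real \<Rightarrow> (real \<Rightarrow> 'a \<Rightarrow> real) set" where
  "D1_space M F T = {X. cadlag_adapted M F T X \<and> class_D M F T X}"


subsection \<open>Finite variation, predictability and local martingales\<close>

definition chains :: "real \<Rightarrow> (nat \<times> (nat \<Rightarrow> real)) set" where
  "chains t = {(n, s). 0 \<le> s 0 \<and> (\<forall>i<n. s i \<le> s (Suc i)) \<and> s n \<le> t}"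

text \<open>
  The components of the Jordan decomposition \<open>f = f 0 + f\<^sup>+ - f\<^sup>-\<close> on \<open>[0,T]\<close> are
  the positive and the negative variation of \<open>f\<close>. Below, this is only used for
  processes starting at \<open>0\<close>.
\<close>

definition pos_variation :: "(real \<Rightarrow> real) \<Rightarrow> real \<Rightarrow> ennreal" where
  "pos_variation f t = (SUP (n, s)\<in>chains t. \<Sum>i<n. ennreal (max (f (s (Suc i)) - f (s i)) 0))"

definition neg_variation :: "(real \<Rightarrow> real) \<Rightarrow> real \<Rightarrow> ennreal" where
  "neg_variation f t = (SUP (n, s)\<in>chains t. \<Sum>i<n. ennreal (max (- (f (s (Suc i)) - f (s i))) 0))"

definition total_variation :: "(real \<Rightarrow> real) \<Rightarrow> real \<Rightarrow> ennreal" where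
  "total_variation f t = pos_variation f t + neg_variation f t"

definition fv_process ::
    "'a measure \<Rightarrow> (real \<Rightarrow> 'a measure) \<Rightarrow> real \<Rightarrow> (real \<Rightarrow> 'a \<Rightarrow> real) \<Rightarrow> bool" where
  "fv_process M F T V \<longleftrightarrow>
     cadlag_adapted M F T V \<and> (\<forall>\<omega>\<in>space M. total_variation (\<lambda>t. V t \<omega>) T < \<infinity>)"

definition predictable_sigma ::
    "'a measure \<Rightarrow> (real \<Rightarrow> 'a measure) \<Rightarrow> real \<Rightarrow> (real \<times> 'a) measure" where
  "predictable_sigma M F T = sigma ({0..T} \<times> space M)
     ({{0} \<times> A | A. A \<in> sets (F 0)} \<union>
      {{s<..t} \<times> A | s t A. 0 \<le> s \<and> s \<le> t \<and> t \<le> T \<and> A \<in> sets (F s)})"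

definition predictable ::
    "'a measure \<Rightarrow> (real \<Rightarrow> 'a measure) \<Rightarrow> real \<Rightarrow> (real \<Rightarrow> 'a \<Rightarrow> real) \<Rightarrow> bool" where
  "predictable M F T V \<longleftrightarrow> (\<lambda>(t, \<omega>). V t \<omega>) \<in> borel_measurable (predictable_sigma M F T)"

definition martingale ::
    "'a measure \<Rightarrow> (real \<Rightarrow> 'a measure) \<Rightarrow> real \<Rightarrow> (real \<Rightarrow> 'a \<Rightarrow> real) \<Rightarrow> bool" where
  "martingale M F T N \<longleftrightarrow>
     (\<forall>t\<in>{0..T}. N t \<in> borel_measurable (F t) \<and> integrable M (N t)) \<and>
     (\<forall>s\<in>{0..T}. \<forall>t\<in>{s..T}. AE \<omega> in M. real_cond_exp M (F s) (N t) \<omega> = N s \<omega>)"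

text \<open>
  On the finite horizon \<open>[0,T]\<close> a localizing sequence has to reach \<open>T\<close> after
  finitely many steps, almost surely; this corresponds to \<open>\<tau>\<^sub>n \<rightarrow> \<infinity>\<close>
  on \<open>[0,\<infinity>)\<close>.
\<close>

definition local_martingale ::
    "'a measure \<Rightarrow> (real \<Rightarrow> 'a measure) \<Rightarrow> real \<Rightarrow> (real \<Rightarrow> 'a \<Rightarrow> real) \<Rightarrow> bool" where
  "local_martingale M F T N \<longleftrightarrow>
     cadlag_adapted M F T N \<and>
     (\<exists>\<tau> :: nat \<Rightarrow> 'a \<Rightarrow> real.
        (\<forall>n. \<tau> n \<in> stopping_times M F T) \<and>
        (\<forall>n. \<forall>\<omega>\<in>space M. \<tau> n \<omega> \<le> \<tau> (Suc n) \<omega>) \<and>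
        (AE \<omega> in M. \<exists>n. \<tau> n \<omega> = T) \<and>
        (\<forall>n. martingale M F T (\<lambda>t \<omega>. N (min t (\<tau> n \<omega>)) \<omega> - N 0 \<omega>)))"


subsection \<open>The spaces \<open>H\<^sup>p\<close>\<close>

definition canonical_decomposition ::
    "'a measure \<Rightarrow> (real \<Rightarrow> 'a measure) \<Rightarrow> real \<Rightarrow> (real \<Rightarrow> 'a \<Rightarrow> real) \<Rightarrow>
     (real \<Rightarrow> 'a \<Rightarrow> real) \<Rightarrow> (real \<Rightarrow> 'a \<Rightarrow> real) \<Rightarrow> bool" where
  "canonical_decomposition M F T X A N \<longleftrightarrow>
     fv_process M F T A \<and> predictable M F T A \<and> (AE \<omega> in M. A 0 \<omega> = 0) \<and>
     local_martingale M F T N \<and> (AE \<omega> in M. N 0 \<omega> = 0) \<and>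
     (AE \<omega> in M. \<forall>t\<in>{0..T}. X t \<omega> = X 0 \<omega> + A t \<omega> + N t \<omega>)"

text \<open>
  A cadlag adapted process with a canonical decomposition is a semimartingale. The
  decomposition is unique up to indistinguishability, so the choice made here
  does not affect the norm below.
\<close>

definition fv_part ::
    "'a measure \<Rightarrow> (real \<Rightarrow> 'a measure) \<Rightarrow> real \<Rightarrow> (real \<Rightarrow> 'a \<Rightarrow> real) \<Rightarrow> real \<Rightarrow> 'a \<Rightarrow> real" where
  "fv_part M F T X = (SOME A. \<exists>N. canonical_decomposition M F T X A N)"

definition Hp_norm ::
    "'a measure \<Rightarrow> (real \<Rightarrow> 'a measure) \<Rightarrow> real \<Rightarrow> real \<Rightarrow> (real \<Rightarrow> 'a \<Rightarrow> real) \<Rightarrow> ennreal" where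
  "Hp_norm M F T p X =
     (let A = fv_part M F T X in
      if 1 < p
      then Sp_norm M T p X + epowr (\<integral>\<^sup>+\<omega>. epowr (total_variation (\<lambda>t. A t \<omega>) T) p \<partial>M) (1 / p)
      else D1_norm M F T X + (\<integral>\<^sup>+\<omega>. total_variation (\<lambda>t. A t \<omega>) T \<partial>M))"

definition Hp_space ::
    "'a measure \<Rightarrow> (real \<Rightarrow> 'a measure) \<Rightarrow> real \<Rightarrow> real \<Rightarrow> (real \<Rightarrow> 'a \<Rightarrow> real) set" where
  "Hp_space M F T p =
     {X. cadlag_adapted M F T X \<and> (\<exists>A N. canonical_decomposition M F T X A N) \<and>
         Hp_norm M F T p X < \<infinity> \<and> (p = 1 \<longrightarrow> X \<in> D1_space M F T)}"


subsection \<open>Mean co-variation\<close>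

text \<open>
  Where both terms are \<open>\<infinity>\<close> the difference carries no information; this happens only on
  a null set when the positive or the negative part of \<open>Y\<close> is integrable.
\<close>

definition ext_cond_exp :: "'a measure \<Rightarrow> 'a measure \<Rightarrow> ('a \<Rightarrow> real) \<Rightarrow> 'a \<Rightarrow> ereal" where
  "ext_cond_exp M G Y \<omega> =
     enn2ereal (nn_cond_exp M G (\<lambda>x. ennreal (max (Y x) 0)) \<omega>) -
     enn2ereal (nn_cond_exp M G (\<lambda>x. ennreal (max (- Y x) 0)) \<omega>)"

definition random_partitions ::
    "'a measure \<Rightarrow> (real \<Rightarrow> 'a measure) \<Rightarrow> real \<Rightarrow> (nat \<times> (nat \<Rightarrow> 'a \<Rightarrow> real)) set" where
  "random_partitions M F T =
     {(n, \<tau>). (\<forall>i\<le>n. \<tau> i \<in> stopping_times M F T) \<and>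
              (\<forall>\<omega>\<in>space M. \<tau> 0 \<omega> = 0 \<and> \<tau> n \<omega> = T \<and> (\<forall>i<n. \<tau> i \<omega> \<le> \<tau> (Suc i) \<omega>))}"

definition mean_covariation ::
    "'a measure \<Rightarrow> (real \<Rightarrow> 'a measure) \<Rightarrow> real \<Rightarrow> real \<Rightarrow>
     (real \<Rightarrow> 'a \<Rightarrow> real) \<Rightarrow> (real \<Rightarrow> 'a \<Rightarrow> real) \<Rightarrow> ennreal" where
  "mean_covariation M F T p L U =
     (SUP (n, \<tau>)\<in>random_partitions M F T.
        \<integral>\<^sup>+\<omega>. epowr (\<Sum>i<n.
          e2ennreal (max 0 (ext_cond_exp M (filtration.pre_sigma (space M) F (\<tau> i))
            (\<lambda>x. L (\<tau> (Suc i) x) x - U (\<tau> i x) x) \<omega>)) +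
          e2ennreal (max 0 (- ext_cond_exp M (filtration.pre_sigma (space M) F (\<tau> i))
            (\<lambda>x. U (\<tau> (Suc i) x) x - L (\<tau> i x) x) \<omega>))) p \<partial>M)"

end

theory Submission
  imports Defs
begin

text \<open>
  Since \<open>L \<le> X \<le> U\<close>, each term of the mean co-variation is controlled by the conditional
  expectation of an increment of \<open>X\<close>, and optional stopping replaces the increments of \<open>X\<close> by
  those of its finite variation part \<open>A\<close>. The sum for a partition is therefore at most
  \<open>\<Sum>i<n. E(\<bar>A (\<tau> (i+1)) - A (\<tau> i)\<bar> | F (\<tau> i))\<close>, whose \<open>L\<^sup>p\<close> norm is at most \<open>p\<close> times that
  of \<open>\<Sum>i<n. \<bar>A (\<tau> (i+1)) - A (\<tau> i)\<bar>\<close> by a dual form of Doob's inequality. The latter sum is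
  bounded by the total variation of \<open>A\<close> on every path.
\<close>

subsection \<open>Conditional expectations of nonnegative sums\<close>

text \<open>\<open>L\<close> and \<open>U\<close> need not be integrable, so the conditional
  expectations in the mean co-variation may be infinite. Positive and negative parts are therefore
  compared separately in \<open>ennreal\<close>, where the integrable increment of \<open>X\<close>
  controls the part that has to stay finite. The local martingale \<open>N\<close> comes without
  integrability. Its localized versions are martingales, and optional stopping for them is obtained
  by rounding stopping times up to finite grids. Both limits, in the grid and in the localizing
  sequence, are exchanged with integrals by uniform integrability, stated as smallness of the
  integrals of \<open>\<bar>Y\<bar> - C\<close> cut off below at 0. The constant:
  \<open>p powr p\<close> in the inequality for p-th moments becomes \<open>p\<close> after the p-th
  root and multiplies only the variation term of the norm of \<open>X\<close>. The 2 counts the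
  positive part of \<open>L\<close> and the negative part of \<open>U\<close>, both below
  \<open>\<bar>X\<bar>\<close>, and multiplies only the other term. Hence a maximum and not a
  sum.\<close>

lemma young_powr:
  fixes x y p :: real
  assumes "1 \<le> p" "0 \<le> x" "0 \<le> y"
  shows "x * y powr (p - 1) \<le> x powr p / p + (1 - 1 / p) * y powr p"
\<comment> \<open>The conjugate exponent \<open>p / (p - 1)\<close> requires \<open>p\<close> above
  1. Otherwise \<open>y powr 0\<close> is 1, or 0 if \<open>y = 0\<close>, and both values satisfy
  the bound.\<close>
proof (cases "p = 1")
  case False
  then have p: "1 < p" using assms by simp
  have "x * y powr (p - 1) \<le> x powr p / p + (y powr (p - 1)) powr (p / (p - 1)) / (p / (p - 1))"
    using p assms by (intro Youngs_inequality) (auto simp: field_simps)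
  also have "(y powr (p - 1)) powr (p / (p - 1)) / (p / (p - 1)) = (1 - 1 / p) * y powr p"
  proof -
    have "(p - 1) * (p / (p - 1)) = p" "1 - 1 / p = 1 / (p / (p - 1))"
      using p by (auto simp: field_simps)
    then show ?thesis
      by (simp add: powr_powr)
  qed
  finally show ?thesis .
qed (use assms in auto)

text \<open>By convexity the tangent to the power function at \<open>y\<close> lies below its graph
  at \<open>x\<close>. The slope sits at \<open>y\<close>, which will be the later of two partial
  sums; that sum is still measurable for the sigma-algebra of the conditional expectation just
  added.\<close>

lemma powr_diff_le:
  fixes x y p :: real
  assumes "1 \<le> p" "0 \<le> x" "0 \<le> y"
  shows "y powr p \<le> x powr p + p * y powr (p - 1) * (y - x)"
proof -
  have "p * (x * y powr (p - 1)) \<le> p * (x powr p / p + (1 - 1 / p) * y powr p)"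
    using assms by (intro mult_left_mono young_powr) auto
  also have "\<dots> = x powr p + (p - 1) * y powr p"
    using assms by (simp add: field_simps)
  finally have "p * (x * y powr (p - 1)) \<le> x powr p + (p - 1) * y powr p" .
  moreover have "y powr p = y powr (p - 1) * y"
    using assms by (cases "y = 0") (auto simp: powr_diff)
  ultimately show ?thesis
    by (simp add: algebra_simps)
qed

section \<open>Powers of extended nonnegative reals\<close>

lemma epowr_ennreal: "0 \<le> x \<Longrightarrow> epowr (ennreal x) p = ennreal (x powr p)"
  by (simp add: epowr_def)

lemma epowr_top [simp]: "epowr \<infinity> p = \<infinity>" "epowr top p = \<infinity>"
  by (auto simp: epowr_def)

lemma epowr_one [simp]: "epowr x 1 = x"
  by (cases x) (auto simp: epowr_def)

lemma epowr_mono: "0 \<le> p \<Longrightarrow> x \<le> y \<Longrightarrow> epowr x p \<le> epowr y p"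
  by (cases x; cases y) (auto simp: epowr_ennreal top_unique intro!: ennreal_leI powr_mono2)

lemma epowr_less_top: "epowr x p < \<infinity> \<longleftrightarrow> x < \<infinity>"
  by (cases x) (auto simp: epowr_ennreal)

lemma epowr_mult_inverse:
  assumes "0 < p" "0 \<le> c"
  shows "epowr (ennreal (c powr p) * x) (1 / p) \<le> ennreal c * epowr x (1 / p)"
proof (cases x)
  case (real r)
  then show ?thesis
    using assms by (simp add: epowr_ennreal powr_mult powr_powr flip: ennreal_mult)
next
  case top
  then show ?thesis
    using assms by (cases "c = 0") (auto simp: ennreal_mult_top epowr_def[of 0])
qed

text \<open>On a probability space the constant 1 has finite integral, so this turns a finite p-th
  moment into integrability.\<close>

lemma le_one_plus_epowr:
  assumes "1 \<le> p"
  shows "x \<le> 1 + epowr x p"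
proof (cases x)
  case (real r)
  have "r \<le> 1 + r powr p"
  proof (cases "r \<le> 1")
    case False
    then have "r powr 1 \<le> r powr p"
      using assms by (intro powr_mono) auto
    then show ?thesis using False by simp
  qed (use powr_ge_zero[of r p] in linarith)
  then show ?thesis
    using real by (simp add: epowr_ennreal flip: ennreal_1 ennreal_plus)
qed (auto simp: epowr_def)

lemma borel_measurable_epowr [measurable]:
  assumes [measurable]: "f \<in> borel_measurable M"
  shows "(\<lambda>x. epowr (f x) p) \<in> borel_measurable M"
  unfolding epowr_def by measurable

text \<open>For finite \<open>s\<close> the truncation is inactive from some \<open>K\<close> on;
  for infinite \<open>s\<close> it leaves \<open>K powr p\<close>, which is at least
  \<open>K\<close> because \<open>1 \<le> p\<close>. This lets monotone convergence remove the
  truncation.\<close>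

lemma epowr_le_SUP_truncation:
  assumes "1 \<le> p"
  shows "epowr s p \<le> (SUP K. ennreal (enn2real (min s (of_nat K)) powr p))"
proof (cases s)
  case (real r)
  obtain K where "r \<le> real K"
    using real_arch_simple by blast
  then have "min s (of_nat K) = s"
    using real by (simp add: min_def ennreal_of_nat_eq_real_of_nat)
  then have "epowr s p = ennreal (enn2real (min s (of_nat K)) powr p)"
    using real by (simp add: epowr_ennreal)
  moreover have "ennreal (enn2real (min s (of_nat K)) powr p)
      \<le> (SUP K. ennreal (enn2real (min s (of_nat K)) powr p))"
    by (rule SUP_upper) simp
  ultimately show ?thesis
    by simp
next
  case top
  have "(SUP K. of_nat K) \<le> (SUP K. ennreal (enn2real (min s (of_nat K)) powr p))"
  proof (rule SUP_mono)
    fix K :: nat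
    show "\<exists>K'\<in>UNIV. of_nat K \<le> ennreal (enn2real (min s (of_nat K')) powr p)"
    proof (intro bexI[of _ K] UNIV_I)
      have "real K \<le> real K powr p"
        using assms powr_mono[of 1 p "real K"] by (cases "K = 0") auto
      then show "of_nat K \<le> ennreal (enn2real (min s (of_nat K)) powr p)"
        using top by (simp add: min_def ennreal_of_nat_eq_real_of_nat top_unique)
    qed
  qed
  then show ?thesis
    by (simp add: ennreal_SUP_of_nat_eq_top top_unique top)
qed

lemma (in prob_space) sigma_finite_subalgebraI:
  "subalgebra M G \<Longrightarrow> sigma_finite_subalgebra M G"
  by (intro finite_measure_subalgebra_is_sigma_finite finite_measure_subalgebra.intro
      finite_measure_subalgebra_axioms.intro finite_measure_axioms)

text \<open>
  With \<open>S k\<close> the partial sums of the conditional expectations, convexity bounds \<open>S n\<close> to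
  the power \<open>p\<close> by the sum of the terms \<open>p * S (k+1) powr (p-1) * E(\<xi> k | G k)\<close>. As
  \<open>S (k+1)\<close> is measurable for \<open>G k\<close>, the conditional expectations can be removed under the
  integral, and Young's inequality absorbs the powers of \<open>S n\<close>. Truncation at
  the level \<open>K\<close> makes the absorbed term finite.
\<close>

lemma (in prob_space) nn_integral_sum_nn_cond_exp_truncated:
  fixes \<xi> :: "nat \<Rightarrow> 'a \<Rightarrow> ennreal" and K n :: nat
  assumes p: "1 \<le> p"
    and G: "\<And>i. i < n \<Longrightarrow> subalgebra M (G i)"
    and G_mono: "\<And>i j. i \<le> j \<Longrightarrow> j < n \<Longrightarrow> sets (G i) \<subseteq> sets (G j)"
    and \<xi>[measurable]: "\<And>i. i < n \<Longrightarrow> \<xi> i \<in> borel_measurable M"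
  defines "S \<equiv> \<lambda>k x. \<Sum>i<k. nn_cond_exp M (G i) (\<xi> i) x"
  shows "(\<integral>\<^sup>+x. ennreal (enn2real (min (S n x) (of_nat K)) powr p) \<partial>M)
    \<le> ennreal (p powr p) * (\<integral>\<^sup>+x. epowr (\<Sum>i<n. \<xi> i x) p \<partial>M)"
proof -
  define R where "R = (\<lambda>k x. enn2real (min (S k x) (of_nat K)))"
  have R_nonneg: "0 \<le> R k x" for k x
    by (simp add: R_def)
  have R_ennreal: "ennreal (R k x) = min (S k x) (of_nat K)" for k x
    unfolding R_def by (subst ennreal_enn2real) (auto simp: min_less_iff_disj ennreal_of_nat_eq_real_of_nat)
  have S_mono: "S j x \<le> S k x" if "j \<le> k" for j k x
    unfolding S_def using that by (intro sum_mono2) auto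
  have R_mono: "R j x \<le> R k x" if "j \<le> k" for j k x
  proof -
    have "ennreal (R j x) \<le> ennreal (R k x)"
      unfolding R_ennreal using S_mono[OF that] by (simp add: min.coboundedI1 min_le_iff_disj)
    then show ?thesis by (simp add: R_nonneg)
  qed
  have cond_exp_G: "nn_cond_exp M (G i) (\<xi> i) \<in> borel_measurable (G k)" if "i \<le> k" "k < n" for i k
  proof (rule measurable_from_subalg)
    show "subalgebra (G k) (G i)"
      using G[of i] G[of k] G_mono[OF that] that by (auto simp: subalgebra_def)
  qed (rule borel_measurable_nn_cond_exp)
  have S_meas: "S (Suc k) \<in> borel_measurable (G k)" if "k < n" for k
    unfolding S_def using that by (intro borel_measurable_sum cond_exp_G) auto
  have R_meas: "R (Suc k) \<in> borel_measurable (G k)" if "k < n" for k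
    unfolding R_def using S_meas[OF that] by measurable
  have S_meas_M [measurable]: "S k \<in> borel_measurable M" for k
    unfolding S_def by measurable
  have R_meas_M [measurable]: "R k \<in> borel_measurable M" for k
    unfolding R_def by measurable
  \<comment> \<open>Capping at \<open>K\<close> is 1-Lipschitz, so the capped sums grow by at most
    the term that is added.\<close>
  have R_diff: "ennreal (R (Suc k) x - R k x) \<le> nn_cond_exp M (G k) (\<xi> k) x" for k x
  proof -
    have "ennreal (R (Suc k) x) \<le> ennreal (R k x) + nn_cond_exp M (G k) (\<xi> k) x"
      unfolding R_ennreal S_def
      by (cases "(\<Sum>i<k. nn_cond_exp M (G i) (\<xi> i) x) \<le> of_nat K")
        (auto simp: min_absorb1 min_absorb2 intro: min.coboundedI1 min.coboundedI2)
    then show ?thesis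
      using R_nonneg[of k x] by (simp add: ennreal_minus[symmetric] ennreal_minus_le_iff)
  qed
  \<comment> \<open>The slope of the power function at \<open>R k x\<close>, as it appears in
    \<open>powr_diff_le\<close>.\<close>
  define c where "c = (\<lambda>k x. p * R k x powr (p - 1))"
  have c_nonneg: "0 \<le> c k x" for k x
    using p by (simp add: c_def)
  have c_mono: "c j x \<le> c k x" if "j \<le> k" for j k x
    unfolding c_def using p R_mono[OF that] R_nonneg by (intro mult_left_mono powr_mono2) auto
  have telescope: "ennreal (R m x powr p) \<le> (\<Sum>k<m. ennreal (c (Suc k) x) * nn_cond_exp M (G k) (\<xi> k) x)" for m x
  proof (induction m)
    case 0
    then show ?case by (simp add: R_def S_def)
  next
    case (Suc m)
    have "R (Suc m) x powr p \<le> R m x powr p + c (Suc m) x * (R (Suc m) x - R m x)"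
      unfolding c_def using p R_nonneg by (intro powr_diff_le) auto
    then have "ennreal (R (Suc m) x powr p)
        \<le> ennreal (R m x powr p) + ennreal (c (Suc m) x) * ennreal (R (Suc m) x - R m x)"
      using R_mono[of m "Suc m" x] c_nonneg[of "Suc m" x]
      by (simp add: ennreal_leI flip: ennreal_mult ennreal_plus)
    also have "\<dots> \<le> (\<Sum>k<m. ennreal (c (Suc k) x) * nn_cond_exp M (G k) (\<xi> k) x)
        + ennreal (c (Suc m) x) * nn_cond_exp M (G m) (\<xi> m) x"
      by (intro add_mono Suc mult_left_mono R_diff) auto
    finally show ?case by simp
  qed
  define I where "I = (\<integral>\<^sup>+x. ennreal (R n x powr p) \<partial>M)"
  define E where "E = (\<integral>\<^sup>+x. epowr (\<Sum>i<n. \<xi> i x) p \<partial>M)"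
  have "I \<le> (\<integral>\<^sup>+x. (\<Sum>k<n. ennreal (c (Suc k) x) * nn_cond_exp M (G k) (\<xi> k) x) \<partial>M)"
    unfolding I_def by (intro nn_integral_mono telescope)
  also have "\<dots> = (\<Sum>k<n. \<integral>\<^sup>+x. ennreal (c (Suc k) x) * nn_cond_exp M (G k) (\<xi> k) x \<partial>M)"
    unfolding c_def by (intro nn_integral_sum) auto
  also have "\<dots> = (\<Sum>k<n. \<integral>\<^sup>+x. ennreal (c (Suc k) x) * \<xi> k x \<partial>M)"
  proof (intro sum.cong refl)
    fix k assume "k \<in> {..<n}"
    then have k: "k < n" by simp
    interpret sigma_finite_subalgebra M "G k"
      using G[OF k] by (rule sigma_finite_subalgebraI)
    show "(\<integral>\<^sup>+x. ennreal (c (Suc k) x) * nn_cond_exp M (G k) (\<xi> k) x \<partial>M)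
        = (\<integral>\<^sup>+x. ennreal (c (Suc k) x) * \<xi> k x \<partial>M)"
      unfolding c_def using R_meas[OF k] \<xi>[OF k] by (intro nn_cond_exp_intg) auto
  qed
  \<comment> \<open>The common factor \<open>c n\<close> may come in only now: it is not measurable
    for the earlier \<open>G k\<close>, so the conditional expectations had to be removed while the
    factor was still \<open>c (Suc k)\<close>.\<close>
  also have "\<dots> \<le> (\<Sum>k<n. \<integral>\<^sup>+x. ennreal (c n x) * \<xi> k x \<partial>M)"
    by (intro sum_mono nn_integral_mono mult_right_mono ennreal_leI c_mono) auto
  also have "\<dots> = (\<integral>\<^sup>+x. ennreal (c n x) * (\<Sum>k<n. \<xi> k x) \<partial>M)"
    unfolding sum_distrib_left c_def by (intro nn_integral_sum[symmetric]) auto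
  also have "\<dots> \<le> (\<integral>\<^sup>+x. ennreal (p powr p / p) * epowr (\<Sum>i<n. \<xi> i x) p
      + ennreal (1 - 1 / p) * ennreal (R n x powr p) \<partial>M)"
  proof (intro nn_integral_mono)
    fix x
    show "ennreal (c n x) * (\<Sum>k<n. \<xi> k x) \<le> ennreal (p powr p / p) * epowr (\<Sum>i<n. \<xi> i x) p
      + ennreal (1 - 1 / p) * ennreal (R n x powr p)"
    proof (cases "\<Sum>k<n. \<xi> k x")
      case (real r)
      \<comment> \<open>Young's inequality is applied to \<open>p * r\<close>, so the factor
        \<open>p\<close> of \<open>c\<close> goes into the first term and the coefficient
        \<open>1 - 1 / p\<close> of the term to be absorbed stays below 1.\<close>
      have "c n x * r \<le> (p * r) powr p / p + (1 - 1 / p) * R n x powr p"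
        using young_powr[of p "p * r" "R n x"] p real R_nonneg by (simp add: c_def algebra_simps)
      then have "c n x * r \<le> p powr p / p * r powr p + (1 - 1 / p) * R n x powr p"
        using p real by (simp add: powr_mult)
      then show ?thesis
        using p real c_nonneg
        by (simp add: epowr_ennreal ennreal_leI flip: ennreal_mult ennreal_plus)
    next
      case top
      show ?thesis
        unfolding top epowr_top using p by (simp add: ennreal_mult_top)
    qed
  qed
  also have "\<dots> = ennreal (p powr p / p) * E + ennreal (1 - 1 / p) * I"
    unfolding E_def I_def by (subst nn_integral_add) (auto simp: nn_integral_cmult)
  finally have I_le: "I \<le> ennreal (p powr p / p) * E + ennreal (1 - 1 / p) * I" .
  \<comment> \<open>Finiteness of \<open>I\<close> allows subtracting
    \<open>(1 - 1 / p) * I\<close>. What remains on the left is \<open>I / p\<close>, and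
    multiplying by \<open>p\<close> turns \<open>p powr p / p\<close> into
    \<open>p powr p\<close>.\<close>
  have "I \<le> (\<integral>\<^sup>+x. ennreal (real K powr p) \<partial>M)"
    unfolding I_def
  proof (intro nn_integral_mono ennreal_leI powr_mono2)
    fix x
    have "ennreal (R n x) \<le> ennreal (real K)"
      unfolding R_ennreal by (simp add: ennreal_of_nat_eq_real_of_nat)
    then show "R n x \<le> real K" by simp
  qed (use p R_nonneg in auto)
  then have "I < \<infinity>"
    by (simp add: emeasure_space_1 order_le_less_trans)
  then obtain i where i: "I = ennreal i" "0 \<le> i"
    by (cases I) auto
  have "I \<le> ennreal (p powr p) * E"
  proof (cases E)
    case (real e)
    then have "i \<le> p powr p / p * e + (1 - 1 / p) * i"
      using I_le i p by (simp flip: ennreal_mult ennreal_plus)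
    then have "i \<le> p powr p * e"
      using p by (simp add: field_simps)
    then show ?thesis
      using i real by (simp add: ennreal_leI flip: ennreal_mult)
  qed (use p in \<open>simp add: ennreal_mult_top\<close>)
  then show ?thesis
    unfolding I_def E_def R_def .
qed

text \<open>The dual form of Doob's inequality. The truncated bound is uniform in \<open>K\<close>,
  so monotone convergence gives it without truncation. For \<open>p = 1\<close> the factor is 1, in
  agreement with the tower property.\<close>

lemma (in prob_space) nn_integral_sum_nn_cond_exp_powr:
  fixes \<xi> :: "nat \<Rightarrow> 'a \<Rightarrow> ennreal" and n :: nat
  assumes p: "1 \<le> p"
    and G: "\<And>i. i < n \<Longrightarrow> subalgebra M (G i)"
    and G_mono: "\<And>i j. i \<le> j \<Longrightarrow> j < n \<Longrightarrow> sets (G i) \<subseteq> sets (G j)"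
    and \<xi>: "\<And>i. i < n \<Longrightarrow> \<xi> i \<in> borel_measurable M"
  shows "(\<integral>\<^sup>+x. epowr (\<Sum>i<n. nn_cond_exp M (G i) (\<xi> i) x) p \<partial>M)
    \<le> ennreal (p powr p) * (\<integral>\<^sup>+x. epowr (\<Sum>i<n. \<xi> i x) p \<partial>M)"
proof -
  define S where "S = (\<lambda>x. \<Sum>i<n. nn_cond_exp M (G i) (\<xi> i) x)"
  define f where "f = (\<lambda>K x. ennreal (enn2real (min (S x) (of_nat K)) powr p))"
  have [measurable]: "S \<in> borel_measurable M"
    unfolding S_def by measurable
  have "incseq f"
  proof (rule incseq_SucI, rule le_funI)
    fix K x
    have "min (S x) (of_nat (Suc K)) < top"
      by (auto simp: min_less_iff_disj ennreal_of_nat_eq_real_of_nat simp del: of_nat_Suc)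
    moreover have "min (S x) (of_nat K) \<le> min (S x) (of_nat (Suc K))"
      by (intro min.mono order_refl of_nat_mono) auto
    ultimately show "f K x \<le> f (Suc K) x"
      unfolding f_def using p by (intro ennreal_leI powr_mono2 enn2real_mono) auto
  qed
  have "(\<integral>\<^sup>+x. epowr (S x) p \<partial>M) \<le> (\<integral>\<^sup>+x. (SUP K. f K x) \<partial>M)"
    unfolding f_def using p by (intro nn_integral_mono epowr_le_SUP_truncation)
  also have "\<dots> = (SUP K. \<integral>\<^sup>+x. f K x \<partial>M)"
    using \<open>incseq f\<close> by (intro nn_integral_monotone_convergence_SUP) (auto simp: f_def)
  also have "\<dots> \<le> ennreal (p powr p) * (\<integral>\<^sup>+x. epowr (\<Sum>i<n. \<xi> i x) p \<partial>M)"
    unfolding f_def S_def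
    by (intro SUP_least nn_integral_sum_nn_cond_exp_truncated p G G_mono \<xi>)
  finally show ?thesis
    unfolding S_def .
qed

subsection \<open>Vanishing tails and convergence of integrals\<close>

text \<open>Uniform integrability in a form adapted to limits. \<open>ennreal\<close> sends negative
  numbers to 0, so the integrand is the positive part of \<open>\<bar>Y\<bar> - C\<close>. As a
  convex and continuous function of \<open>Y\<close>, it is compatible with conditional expectations
  (Jensen) and with almost sure limits (Fatou), unlike the tail cut off by an indicator.\<close>

definition vanishing_tails :: "'a measure \<Rightarrow> ('a \<Rightarrow> real) set \<Rightarrow> bool" where
  "vanishing_tails M \<Y> \<longleftrightarrow> \<Y> \<subseteq> borel_measurable M \<and>
     (\<forall>e>0. \<exists>C\<ge>0. \<forall>Y\<in>\<Y>. (\<integral>\<^sup>+x. ennreal (\<bar>Y x\<bar> - C) \<partial>M) \<le> ennreal e)"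

lemma vanishing_tails_mono: "vanishing_tails M \<Y> \<Longrightarrow> \<Z> \<subseteq> \<Y> \<Longrightarrow> vanishing_tails M \<Z>"
  unfolding vanishing_tails_def by (meson order_trans subset_iff)

lemma vanishing_tails_measurable: "vanishing_tails M \<Y> \<Longrightarrow> Y \<in> \<Y> \<Longrightarrow> Y \<in> borel_measurable M"
  by (auto simp: vanishing_tails_def)

lemma integrable_nn_integral_tail:
  assumes "integrable M V" "0 < (e::real)"
  shows "\<exists>C\<ge>0. (\<integral>\<^sup>+x. ennreal (\<bar>V x\<bar> - C) \<partial>M) \<le> ennreal e"
proof -
  have [measurable]: "V \<in> borel_measurable M"
    using assms by simp
  have "(\<lambda>n. \<integral>\<^sup>+x. ennreal (\<bar>V x\<bar> - real n) \<partial>M) \<longlonglongrightarrow> (\<integral>\<^sup>+x. 0 \<partial>M)"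
  proof (rule nn_integral_dominated_convergence)
    show "(\<integral>\<^sup>+x. ennreal \<bar>V x\<bar> \<partial>M) < \<infinity>"
      using assms by (simp add: integrable_iff_bounded)
    show "AE x in M. (\<lambda>n. ennreal (\<bar>V x\<bar> - real n)) \<longlonglongrightarrow> 0"
    proof (intro AE_I2 tendsto_eventually)
      fix x
      obtain N where "\<bar>V x\<bar> \<le> real N"
        using real_arch_simple by blast
      then show "\<forall>\<^sub>F n in sequentially. ennreal (\<bar>V x\<bar> - real n) = 0"
        unfolding eventually_sequentially by (intro exI[of _ N]) (auto simp: ennreal_eq_0_iff)
    qed
  qed (auto intro: ennreal_leI)
  then have "(\<lambda>n. \<integral>\<^sup>+x. ennreal (\<bar>V x\<bar> - real n) \<partial>M) \<longlonglongrightarrow> 0"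
    by simp
  then have "\<forall>\<^sub>F n in sequentially. (\<integral>\<^sup>+x. ennreal (\<bar>V x\<bar> - real n) \<partial>M) < ennreal e"
    using assms by (intro order_tendstoD) auto
  then obtain n where "(\<integral>\<^sup>+x. ennreal (\<bar>V x\<bar> - real n) \<partial>M) < ennreal e"
    by (auto simp: eventually_sequentially)
  then show ?thesis
    by (intro exI[of _ "real n"]) auto
qed

lemma vanishing_tails_dominated:
  assumes "integrable M V" "\<Y> \<subseteq> borel_measurable M"
    and "\<And>Y. Y \<in> \<Y> \<Longrightarrow> AE x in M. \<bar>Y x\<bar> \<le> V x"
  shows "vanishing_tails M \<Y>"
  unfolding vanishing_tails_def
proof (intro conjI allI impI assms)
  fix e :: real assume "0 < e"
  from integrable_nn_integral_tail[OF assms(1) this]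
  obtain C where C: "0 \<le> C" "(\<integral>\<^sup>+x. ennreal (\<bar>V x\<bar> - C) \<partial>M) \<le> ennreal e"
    by auto
  have "(\<integral>\<^sup>+x. ennreal (\<bar>Y x\<bar> - C) \<partial>M) \<le> (\<integral>\<^sup>+x. ennreal (\<bar>V x\<bar> - C) \<partial>M)" if "Y \<in> \<Y>" for Y
    using assms(3)[OF that] by (intro nn_integral_mono_AE, eventually_elim) (auto intro!: ennreal_leI)
  with C show "\<exists>C\<ge>0. \<forall>Y\<in>\<Y>. (\<integral>\<^sup>+x. ennreal (\<bar>Y x\<bar> - C) \<partial>M) \<le> ennreal e"
    by (intro exI[of _ C]) (auto intro: order_trans)
qed

text \<open>For \<open>0 \<le> c\<close> the positive part of \<open>\<bar>Y\<bar> - c\<close> is at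
  most \<open>\<bar>Y\<bar>\<close> where \<open>c < \<bar>Y\<bar>\<close>, and it is 0
  elsewhere.\<close>

lemma uniformly_integrable_imp_vanishing_tails:
  assumes "uniformly_integrable M \<Y>"
  shows "vanishing_tails M \<Y>"
  unfolding vanishing_tails_def
proof (intro conjI allI impI)
  show "\<Y> \<subseteq> borel_measurable M"
    using assms by (simp add: uniformly_integrable_def)
  fix e :: real assume "0 < e"
  let ?f = "\<lambda>c. SUP Y\<in>\<Y>. \<integral>\<^sup>+x\<in>{x. c < \<bar>Y x\<bar>}. ennreal \<bar>Y x\<bar> \<partial>M"
  have "(?f \<longlongrightarrow> 0) at_top"
    using assms by (simp add: uniformly_integrable_def)
  then have "\<forall>\<^sub>F c in at_top. ?f c < ennreal e \<and> 0 \<le> c"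
    using \<open>0 < e\<close> by (intro eventually_conj order_tendstoD eventually_ge_at_top) auto
  then obtain c where c: "?f c < ennreal e" "0 \<le> c"
    by (auto simp: eventually_at_top_linorder)
  have "(\<integral>\<^sup>+x. ennreal (\<bar>Y x\<bar> - c) \<partial>M) \<le> ennreal e" if "Y \<in> \<Y>" for Y
  proof -
    have "(\<integral>\<^sup>+x. ennreal (\<bar>Y x\<bar> - c) \<partial>M) \<le> (\<integral>\<^sup>+x\<in>{x. c < \<bar>Y x\<bar>}. ennreal \<bar>Y x\<bar> \<partial>M)"
      using c(2) by (intro nn_integral_mono) (auto simp: indicator_def ennreal_leI ennreal_eq_0_iff)
    also have "\<dots> \<le> ?f c"
      using that by (rule SUP_upper)
    finally show ?thesis
      using c(1) by auto
  qed
  then show "\<exists>C\<ge>0. \<forall>Y\<in>\<Y>. (\<integral>\<^sup>+x. ennreal (\<bar>Y x\<bar> - C) \<partial>M) \<le> ennreal e"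
    using c(2) by auto
qed

text \<open>\<open>\<bar>Y\<bar>\<close> is at most \<open>C\<close> plus its tail above
  \<open>C\<close>, and constants are integrable here.\<close>

lemma (in prob_space) vanishing_tails_integrable:
  assumes "vanishing_tails M \<Y>" "Y \<in> \<Y>"
  shows "integrable M Y"
proof -
  have [measurable]: "Y \<in> borel_measurable M"
    using assms by (rule vanishing_tails_measurable)
  have "\<exists>C\<ge>0. \<forall>Y\<in>\<Y>. (\<integral>\<^sup>+x. ennreal (\<bar>Y x\<bar> - C) \<partial>M) \<le> ennreal 1"
    using assms unfolding vanishing_tails_def by (metis zero_less_one)
  then obtain C where C: "0 \<le> C" "(\<integral>\<^sup>+x. ennreal (\<bar>Y x\<bar> - C) \<partial>M) \<le> ennreal 1"
    using assms by auto
  have "(\<integral>\<^sup>+x. ennreal (norm (Y x)) \<partial>M) \<le> (\<integral>\<^sup>+x. ennreal C + ennreal (\<bar>Y x\<bar> - C) \<partial>M)"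
  proof (intro nn_integral_mono)
    fix x show "ennreal (norm (Y x)) \<le> ennreal C + ennreal (\<bar>Y x\<bar> - C)"
    proof (cases "C \<le> \<bar>Y x\<bar>")
      case True
      then show ?thesis
        using C(1) by (simp flip: ennreal_plus)
    qed (simp add: ennreal_leI add_increasing2)
  qed
  also have "\<dots> = ennreal C + (\<integral>\<^sup>+x. ennreal (\<bar>Y x\<bar> - C) \<partial>M)"
    by (subst nn_integral_add) (auto simp: emeasure_space_1)
  also have "\<dots> < \<infinity>"
    using C(2) by (auto simp: order_le_less_trans)
  finally show ?thesis
    by (simp add: integrable_iff_bounded)
qed

text \<open>Fatou's lemma: the tail integrand depends continuously on the value, so the level
  \<open>C\<close> of the sequence also serves the limit.\<close>

lemma vanishing_tails_limit:
  assumes "vanishing_tails M (range Y)" and [measurable]: "Z \<in> borel_measurable M"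
    and lim: "AE x in M. (\<lambda>k. Y k x) \<longlonglongrightarrow> Z x"
  shows "vanishing_tails M (insert Z (range Y))"
  unfolding vanishing_tails_def
proof (intro conjI allI impI)
  have [measurable]: "Y k \<in> borel_measurable M" for k
    using assms(1) by (auto simp: vanishing_tails_def)
  then show "insert Z (range Y) \<subseteq> borel_measurable M"
    by auto
  fix e :: real assume "0 < e"
  then obtain C where C: "0 \<le> C" "\<And>k. (\<integral>\<^sup>+x. ennreal (\<bar>Y k x\<bar> - C) \<partial>M) \<le> ennreal e"
    using assms(1) unfolding vanishing_tails_def by (metis rangeI)
  have "(\<integral>\<^sup>+x. ennreal (\<bar>Z x\<bar> - C) \<partial>M) = (\<integral>\<^sup>+x. liminf (\<lambda>k. ennreal (\<bar>Y k x\<bar> - C)) \<partial>M)"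
    using lim
  proof (intro nn_integral_cong_AE, eventually_elim)
    fix x assume "(\<lambda>k. Y k x) \<longlonglongrightarrow> Z x"
    then have "(\<lambda>k. ennreal (\<bar>Y k x\<bar> - C)) \<longlonglongrightarrow> ennreal (\<bar>Z x\<bar> - C)"
      by (intro tendsto_intros tendsto_ennrealI)
    then show "ennreal (\<bar>Z x\<bar> - C) = liminf (\<lambda>k. ennreal (\<bar>Y k x\<bar> - C))"
      by (simp add: lim_imp_Liminf)
  qed
  also have "\<dots> \<le> liminf (\<lambda>k. \<integral>\<^sup>+x. ennreal (\<bar>Y k x\<bar> - C) \<partial>M)"
    by (intro nn_integral_liminf) auto
  also have "\<dots> \<le> ennreal e"
    using C(2) by (intro Liminf_le) (auto intro: always_eventually)
  finally show "\<exists>C\<ge>0. \<forall>Y\<in>insert Z (range Y). (\<integral>\<^sup>+x. ennreal (\<bar>Y x\<bar> - C) \<partial>M) \<le> ennreal e"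
    using C by auto
qed

text \<open>Vitali's theorem: clipping at the level \<open>C\<close> reduces it to bounded convergence.\<close>

lemma (in prob_space) vanishing_tails_tendsto_integral:
  assumes tails: "vanishing_tails M (range Y)" and [measurable]: "Z \<in> borel_measurable M"
    and lim: "AE x in M. (\<lambda>k. Y k x) \<longlonglongrightarrow> Z x" and A[measurable]: "A \<in> sets M"
  shows "integrable M Z"
    and "(\<lambda>k. \<integral>x. indicator A x * Y k x \<partial>M) \<longlonglongrightarrow> (\<integral>x. indicator A x * Z x \<partial>M)"
proof -
  have tails': "vanishing_tails M (insert Z (range Y))"
    using vanishing_tails_limit[OF tails _ lim] by simp
  have integrable: "integrable M W" if "W \<in> insert Z (range Y)" for W
    using tails' that by (rule vanishing_tails_integrable)
  show "integrable M Z"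
    by (simp add: integrable)
  have [measurable]: "Y k \<in> borel_measurable M" for k
    using integrable by auto
  show "(\<lambda>k. \<integral>x. indicator A x * Y k x \<partial>M) \<longlonglongrightarrow> (\<integral>x. indicator A x * Z x \<partial>M)"
  proof (rule tendstoI)
    fix e :: real assume "0 < e"
    then have "0 < e / 3" by simp
    then obtain C where C: "0 \<le> C"
      "\<And>W. W \<in> insert Z (range Y) \<Longrightarrow> (\<integral>\<^sup>+x. ennreal (\<bar>W x\<bar> - C) \<partial>M) \<le> ennreal (e / 3)"
      using tails' unfolding vanishing_tails_def by metis
    define clip where "clip = (\<lambda>r. max (- C) (min C r))"
    have [measurable]: "clip \<in> borel_measurable borel"
      unfolding clip_def by measurable
    have clip_bound: "\<bar>clip r\<bar> \<le> C" for r
      using C(1) by (auto simp: clip_def)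
    \<comment> \<open>The clipping error is exactly the tail above \<open>C\<close>. It costs
      \<open>e / 3\<close> for the limit and \<open>e / 3\<close> for a member of the sequence,
      uniformly; the last third is left for bounded convergence.\<close>
    have clip_diff: "\<bar>(\<integral>x. indicator A x * W x \<partial>M) - (\<integral>x. indicator A x * clip (W x) \<partial>M)\<bar> \<le> e / 3"
      if W: "W \<in> insert Z (range Y)" for W
    proof -
      have [measurable]: "W \<in> borel_measurable M"
        using integrable[OF W] by simp
      have "integrable M (\<lambda>x. clip (W x))"
        using clip_bound by (intro integrable_const_bound[where B=C]) auto
      then have "(\<integral>x. indicator A x * W x \<partial>M) - (\<integral>x. indicator A x * clip (W x) \<partial>M)
          = (\<integral>x. indicator A x * (W x - clip (W x)) \<partial>M)"
        using integrable_mult_indicator[OF A integrable[OF W]]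
          integrable_mult_indicator[OF A, of "\<lambda>x. clip (W x)"]
        by (simp add: right_diff_distrib)
      also have "\<bar>\<dots>\<bar> \<le> (\<integral>x. \<bar>indicator A x * (W x - clip (W x))\<bar> \<partial>M)"
        by (rule integral_abs_bound)
      also have "\<dots> \<le> e / 3"
      proof (rule integral_real_bounded)
        have "(\<integral>\<^sup>+x. ennreal \<bar>indicator A x * (W x - clip (W x))\<bar> \<partial>M) \<le> (\<integral>\<^sup>+x. ennreal (\<bar>W x\<bar> - C) \<partial>M)"
        proof (intro nn_integral_mono)
          fix x
          have "\<bar>indicator A x * (W x - clip (W x))\<bar> \<le> max 0 (\<bar>W x\<bar> - C)"
            using C(1) by (auto simp: clip_def indicator_def)
          then have "ennreal \<bar>indicator A x * (W x - clip (W x))\<bar> \<le> ennreal (max 0 (\<bar>W x\<bar> - C))"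
            by (rule ennreal_leI)
          then show "ennreal \<bar>indicator A x * (W x - clip (W x))\<bar> \<le> ennreal (\<bar>W x\<bar> - C)"
            by (cases "0 \<le> \<bar>W x\<bar> - C") (simp_all add: max_def ennreal_neg)
        qed
        with C(2)[OF W] show "(\<integral>\<^sup>+x. ennreal \<bar>indicator A x * (W x - clip (W x))\<bar> \<partial>M) \<le> ennreal (e / 3)"
          by (rule order_trans[rotated])
      qed (use \<open>0 < e\<close> in simp)
      finally show ?thesis .
    qed
    have "(\<lambda>k. \<integral>x. indicator A x * clip (Y k x) \<partial>M) \<longlonglongrightarrow> (\<integral>x. indicator A x * clip (Z x) \<partial>M)"
    proof (rule integral_dominated_convergence[where w="\<lambda>_. C"])
      show "AE x in M. (\<lambda>k. indicator A x * clip (Y k x)) \<longlonglongrightarrow> indicator A x * clip (Z x)"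
        using lim unfolding clip_def by eventually_elim (intro tendsto_intros)
      show "AE x in M. norm (indicator A x * clip (Y k x)) \<le> C" for k
        using clip_bound C(1) by (auto simp: indicator_def)
    qed auto
    then have "\<forall>\<^sub>F k in sequentially. dist (\<integral>x. indicator A x * clip (Y k x) \<partial>M)
        (\<integral>x. indicator A x * clip (Z x) \<partial>M) < e / 3"
      using \<open>0 < e / 3\<close> by (rule tendstoD)
    then show "\<forall>\<^sub>F k in sequentially. dist (\<integral>x. indicator A x * Y k x \<partial>M)
        (\<integral>x. indicator A x * Z x \<partial>M) < e"
    proof eventually_elim
      case (elim k)
      then show ?case
        using clip_diff[OF insertI1] clip_diff[OF insertI2[OF rangeI], of k]
        unfolding dist_real_def by linarith
    qed
  qed
qed

subsection \<open>Discretization of times\<close>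

text \<open>Rounding up keeps the discretized time a stopping time and lets it approach the original
  time from the right, where the paths are continuous. Using \<open>Suc k\<close> cells avoids an
  empty grid.\<close>

definition grid_index :: "real \<Rightarrow> nat \<Rightarrow> real \<Rightarrow> nat" where
  "grid_index T k t = nat \<lceil>t * real (Suc k) / T\<rceil>"

text \<open>The cap sends every natural index into \<open>{0..T}\<close>, so a process can be
  evaluated over all indices without a side condition.\<close>

definition grid_point :: "real \<Rightarrow> nat \<Rightarrow> nat \<Rightarrow> real" where
  "grid_point T k i = T * real (min i (Suc k)) / real (Suc k)"

lemma grid_point_in: "0 < T \<Longrightarrow> grid_point T k i \<in> {0..T}"
  by (auto simp: grid_point_def divide_le_eq intro!: mult_left_mono)

text \<open>This translates events about the index into events \<open>\<tau> \<le> t\<close>, which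
  the stopping time property controls.\<close>

lemma grid_index_le_iff:
  assumes "0 < T" "i \<le> Suc k"
  shows "grid_index T k t \<le> i \<longleftrightarrow> t \<le> grid_point T k i"
  using assms by (simp add: grid_index_def grid_point_def ceiling_le_iff nat_le_iff field_simps)

lemma grid_index_le: "0 < T \<Longrightarrow> t \<in> {0..T} \<Longrightarrow> grid_index T k t \<le> Suc k"
  by (subst grid_index_le_iff) (auto simp: grid_point_def)

lemma grid_point_index_bounds:
  assumes "0 < T" "t \<in> {0..T}"
  shows "t \<le> grid_point T k (grid_index T k t)"
    and "grid_point T k (grid_index T k t) \<le> t + T / real (Suc k)"
proof -
  show "t \<le> grid_point T k (grid_index T k t)"
    using grid_index_le_iff[OF assms(1) grid_index_le[OF assms]] by blast
  have "real (grid_index T k t) \<le> t * real (Suc k) / T + 1"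
  proof -
    have "0 \<le> t * real (Suc k) / T"
      using assms by simp
    then have "0 \<le> \<lceil>t * real (Suc k) / T\<rceil>"
      by linarith
    then show ?thesis
      unfolding grid_index_def by (subst of_nat_nat) (auto intro: of_int_ceiling_le_add_one)
  qed
  then have "T * real (grid_index T k t) / real (Suc k) \<le> T * (t * real (Suc k) / T + 1) / real (Suc k)"
    using assms by (intro divide_right_mono mult_left_mono) auto
  also have "\<dots> = t + T / real (Suc k)"
    using assms by (simp add: field_simps del: of_nat_Suc)
  finally show "grid_point T k (grid_index T k t) \<le> t + T / real (Suc k)"
    using grid_index_le[OF assms, of k] by (simp add: grid_point_def min_absorb1 del: of_nat_Suc)
qed

lemma grid_point_index_tendsto:
  assumes "0 < T" "t \<in> {0..T}" and f: "\<And>t. t \<in> {0..<T} \<Longrightarrow> continuous (at_right t) f"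
  shows "(\<lambda>k. f (grid_point T k (grid_index T k t))) \<longlonglongrightarrow> f t"
proof (cases "t = T")
  case True
  \<comment> \<open>Right continuity is available only before \<open>T\<close>. At \<open>T\<close>
    the approximation is exact: the grid point is at least \<open>t = T\<close> and at most
    \<open>T\<close>.\<close>
  have "grid_point T k (grid_index T k t) = T" for k
    using grid_point_index_bounds[OF assms(1,2), of k] grid_point_in[OF assms(1), of k "grid_index T k t"] True
    by auto
  then show ?thesis
    using True by simp
next
  case False
  have "(\<lambda>k. grid_point T k (grid_index T k t)) \<longlonglongrightarrow> t"
  proof (rule tendsto_sandwich[where f="\<lambda>_. t" and h="\<lambda>k. t + T / real (Suc k)"])
    have "(\<lambda>k. t + T * inverse (real (Suc k))) \<longlonglongrightarrow> t + T * 0"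
      by (intro tendsto_intros LIMSEQ_inverse_real_of_nat)
    then show "(\<lambda>k. t + T / real (Suc k)) \<longlonglongrightarrow> t"
      by (simp add: divide_inverse)
  qed (intro always_eventually allI grid_point_index_bounds[OF assms(1,2)] tendsto_const)+
  moreover have "continuous (at_right t) f"
    using f assms(2) False by auto
  \<comment> \<open>The grid points may coincide with \<open>t\<close>, so the filter has to include
    the point itself.\<close>
  then have "continuous (at t within {t..}) f"
    by (simp add: continuous_within at_within_Ici_at_right)
  ultimately show ?thesis
    using grid_point_index_bounds(1)[OF assms(1,2)] unfolding continuous_within_sequentially
    by (auto simp: comp_def dest!: spec[of _ "\<lambda>k. grid_point T k (grid_index T k t)"])
qed

lemma cadlag_on_right_continuous: "cadlag_on T f \<Longrightarrow> t \<in> {0..<T} \<Longrightarrow> continuous (at_right t) f"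
  by (simp add: cadlag_on_def)

lemma measurable_grid_index [measurable]: "grid_index T k \<in> borel \<rightarrow>\<^sub>M count_space UNIV"
  unfolding grid_index_def by measurable

section \<open>Processes evaluated at random times\<close>

lemma borel_measurable_evaluate_grid_index:
  assumes "\<And>t. t \<in> {0..T} \<Longrightarrow> Z t \<in> borel_measurable M" "0 < T"
    and [measurable]: "\<tau> \<in> borel_measurable M"
  shows "(\<lambda>x. Z (grid_point T k (grid_index T k (\<tau> x))) x) \<in> borel_measurable M"
  by (rule measurable_compose_countable[where f="\<lambda>i x. Z (grid_point T k i) x"])
    (use assms grid_point_in in auto)

lemma borel_measurable_evaluate:
  fixes Z :: "real \<Rightarrow> 'a \<Rightarrow> real"
  assumes "\<And>t. t \<in> {0..T} \<Longrightarrow> Z t \<in> borel_measurable M" "0 < T"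
    and "\<And>x t. x \<in> space M \<Longrightarrow> t \<in> {0..<T} \<Longrightarrow> continuous (at_right t) (\<lambda>t. Z t x)"
    and "\<tau> \<in> borel_measurable M" "\<And>x. x \<in> space M \<Longrightarrow> \<tau> x \<in> {0..T}"
  shows "(\<lambda>x. Z (\<tau> x) x) \<in> borel_measurable M"
proof (rule borel_measurable_LIMSEQ_metric)
  show "(\<lambda>x. Z (grid_point T k (grid_index T k (\<tau> x))) x) \<in> borel_measurable M" for k
    by (rule borel_measurable_evaluate_grid_index[OF assms(1,2,4)])
  show "(\<lambda>k. Z (grid_point T k (grid_index T k (\<tau> x))) x) \<longlonglongrightarrow> Z (\<tau> x) x" if "x \<in> space M" for x
    by (rule grid_point_index_tendsto[where f="\<lambda>t. Z t x", OF assms(2) assms(5)[OF that] assms(3)[OF that]])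
qed

text \<open>The supremum over the grid points is a measurable version of the supremum over all times.\<close>

lemma right_continuous_dominated:
  fixes Z :: "real \<Rightarrow> 'a \<Rightarrow> real" and g :: "'a \<Rightarrow> ennreal"
  assumes "prob_space M"
    and Z: "\<And>t. t \<in> {0..T} \<Longrightarrow> Z t \<in> borel_measurable M" and "0 < T"
    and rc: "\<And>x t. x \<in> space M \<Longrightarrow> t \<in> {0..<T} \<Longrightarrow> continuous (at_right t) (\<lambda>t. Z t x)"
    and g: "\<And>x t. x \<in> space M \<Longrightarrow> t \<in> {0..T} \<Longrightarrow> ennreal \<bar>Z t x\<bar> \<le> 1 + g x"
    and "(\<integral>\<^sup>+x. g x \<partial>M) < \<infinity>"
  shows "\<exists>V. integrable M V \<and> (AE x in M. \<forall>t\<in>{0..T}. \<bar>Z t x\<bar> \<le> V x)"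
proof -
  interpret prob_space M by fact
  define S where "S = (\<lambda>x. SUP ki. ennreal \<bar>Z (grid_point T (fst ki) (snd ki)) x\<bar>)"
  have [measurable]: "Z (grid_point T k i) \<in> borel_measurable M" for k i
    using Z grid_point_in[OF \<open>0 < T\<close>] by blast
  have [measurable]: "S \<in> borel_measurable M"
    unfolding S_def by measurable
  \<comment> \<open>\<open>g\<close> is not assumed measurable, so the integral of
    \<open>1 + g\<close> cannot be split. The measurable \<open>S\<close> is split instead, and
    \<open>g\<close> enters only through monotonicity.\<close>
  have "(\<integral>\<^sup>+x. S x \<partial>M) \<le> (\<integral>\<^sup>+x. 1 + (S x - 1) \<partial>M)"
    by (intro nn_integral_mono) (simp add: ennreal_minus_le_iff[THEN iffD1, OF order_refl])
  also have "\<dots> = 1 + (\<integral>\<^sup>+x. S x - 1 \<partial>M)"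
    by (subst nn_integral_add) (auto simp: emeasure_space_1)
  also have "(\<integral>\<^sup>+x. S x - 1 \<partial>M) \<le> (\<integral>\<^sup>+x. g x \<partial>M)"
  proof (intro nn_integral_mono)
    fix x assume "x \<in> space M"
    then have "S x \<le> 1 + g x"
      unfolding S_def using g grid_point_in[OF \<open>0 < T\<close>] by (intro SUP_least) auto
    then show "S x - 1 \<le> g x"
      by (simp add: ennreal_minus_le_iff)
  qed
  finally have "(\<integral>\<^sup>+x. S x \<partial>M) < \<infinity>"
    using assms(6) by (simp add: add_left_mono order_le_less_trans)
  then have fin: "AE x in M. S x \<noteq> \<infinity>"
    by (intro nn_integral_PInf_AE) auto
  show ?thesis
  proof (intro exI conjI)
    have "(\<integral>\<^sup>+x. ennreal (norm (enn2real (S x))) \<partial>M) = (\<integral>\<^sup>+x. S x \<partial>M)"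
      using fin by (intro nn_integral_cong_AE) (auto simp: less_top)
    then show "integrable M (\<lambda>x. enn2real (S x))"
      using \<open>(\<integral>\<^sup>+x. S x \<partial>M) < \<infinity>\<close> by (simp add: integrable_iff_bounded)
    show "AE x in M. \<forall>t\<in>{0..T}. \<bar>Z t x\<bar> \<le> enn2real (S x)"
      using fin AE_space
    proof eventually_elim
      case (elim x)
      show ?case
      proof
        fix t assume t: "t \<in> {0..T}"
        have "(\<lambda>k. \<bar>Z (grid_point T k (grid_index T k t)) x\<bar>) \<longlonglongrightarrow> \<bar>Z t x\<bar>"
          using t \<open>0 < T\<close> rc[OF elim(2)]
          by (intro tendsto_intros grid_point_index_tendsto[where f="\<lambda>t. Z t x"]) auto
        moreover have "\<bar>Z (grid_point T k i) x\<bar> \<le> enn2real (S x)" for k i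
        proof -
          have "ennreal \<bar>Z (grid_point T k i) x\<bar> \<le> S x"
            unfolding S_def by (rule SUP_upper2[of "(k, i)"]) auto
          then show ?thesis
            using elim(1) by (metis abs_ge_zero enn2real_ennreal enn2real_mono infinity_ennreal_def less_top)
        qed
        ultimately show "\<bar>Z t x\<bar> \<le> enn2real (S x)"
          by (intro LIMSEQ_le_const2) auto
      qed
    qed
  qed
qed

subsection \<open>Optional stopping\<close>

context usual_filtered_prob_space
begin

section \<open>Stopping times and the sigma-algebras of their pasts\<close>

lemma subalgebra_F: "subalgebra M (F t)"
  by (simp add: subalgebra_def space_F sets_F_subset)

lemma borel_measurable_F: "f \<in> borel_measurable (F t) \<Longrightarrow> f \<in> borel_measurable M"
  by (rule measurable_from_subalg[OF subalgebra_F])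

lemma stopping_times_measurable: "\<tau> \<in> stopping_times M F T \<Longrightarrow> \<tau> \<in> borel_measurable M"
  unfolding stopping_times_def
  by (intro measurable_stopping_time[of F]) (auto simp: space_F dest: sets_F_subset[THEN subsetD])

lemma stopping_times_in: "\<tau> \<in> stopping_times M F T \<Longrightarrow> \<omega> \<in> space M \<Longrightarrow> \<tau> \<omega> \<in> {0..T}"
  by (auto simp: stopping_times_def)

lemma stopping_timesD: "\<tau> \<in> stopping_times M F T \<Longrightarrow> stopping_time F \<tau>"
  by (simp add: stopping_times_def)

lemma stopping_times_min:
  "\<sigma> \<in> stopping_times M F T \<Longrightarrow> \<tau> \<in> stopping_times M F T \<Longrightarrow> (\<lambda>\<omega>. min (\<sigma> \<omega>) (\<tau> \<omega>)) \<in> stopping_times M F T"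
  by (auto simp: stopping_times_def min_le_iff_disj intro: stopping_time_min)

lemma sets_pre_sigma_subset:
  assumes "\<tau> \<in> stopping_times M F T"
  shows "sets (pre_sigma \<tau>) \<subseteq> sets M"
proof
  fix A assume A: "A \<in> sets (pre_sigma \<tau>)"
  then have "A \<subseteq> space M"
    using sets.sets_into_space space_pre_sigma by blast
  then have "{\<omega> \<in> A. \<tau> \<omega> \<le> T} = A"
    using stopping_times_in[OF assms] by auto
  then show "A \<in> sets M"
    using sets_pre_sigmaD[OF stopping_timesD[OF assms] A, of T] sets_F_subset by auto
qed

lemma subalgebra_pre_sigma:
  "\<tau> \<in> stopping_times M F T \<Longrightarrow> subalgebra M (pre_sigma \<tau>)"
  by (simp add: subalgebra_def space_pre_sigma sets_pre_sigma_subset)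

lemma cadlag_adapted_measurable:
  "cadlag_adapted M F T Z \<Longrightarrow> t \<in> {0..T} \<Longrightarrow> Z t \<in> borel_measurable M"
  by (rule borel_measurable_F[of _ t]) (auto simp: cadlag_adapted_def)

lemma cadlag_adapted_right_continuous:
  "cadlag_adapted M F T Z \<Longrightarrow> \<omega> \<in> space M \<Longrightarrow> t \<in> {0..<T} \<Longrightarrow> continuous (at_right t) (\<lambda>t. Z t \<omega>)"
  by (auto simp: cadlag_adapted_def intro: cadlag_on_right_continuous)

lemma cadlag_adapted_evaluate_measurable:
  assumes "cadlag_adapted M F T Z" "0 < T" "\<tau> \<in> stopping_times M F T"
  shows "(\<lambda>\<omega>. Z (\<tau> \<omega>) \<omega>) \<in> borel_measurable M"
  by (rule borel_measurable_evaluate[OF cadlag_adapted_measurable[OF assms(1)] assms(2)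
      cadlag_adapted_right_continuous[OF assms(1)] stopping_times_measurable[OF assms(3)]
      stopping_times_in[OF assms(3)]])

lemma martingale_integral:
  assumes "martingale M F T Y" "t \<in> {0..T}" "A \<in> sets (F t)"
  shows "(\<integral>\<omega>. indicator A \<omega> * Y t \<omega> \<partial>M) = (\<integral>\<omega>. indicator A \<omega> * Y T \<omega> \<partial>M)"
proof -
  interpret sigma_finite_subalgebra M "F t"
    by (intro sigma_finite_subalgebraI subalgebra_F)
  have T: "T \<in> {t..T}" "T \<in> {0..T}"
    using assms(2) by auto
  have int: "integrable M (Y t)" "integrable M (Y T)"
    and ae: "AE \<omega> in M. real_cond_exp M (F t) (Y T) \<omega> = Y t \<omega>"
    using assms(1,2) T unfolding martingale_def by blast+
  have [measurable]: "A \<in> sets M" "Y t \<in> borel_measurable M"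
    using assms(3) sets_F_subset int by auto
  have "(\<integral>\<omega>. indicator A \<omega> * Y T \<omega> \<partial>M) = (\<integral>\<omega>. indicator A \<omega> * real_cond_exp M (F t) (Y T) \<omega> \<partial>M)"
    using real_cond_exp_intA[OF int(2) assms(3)] by (simp add: set_lebesgue_integral_def)
  also have "\<dots> = (\<integral>\<omega>. indicator A \<omega> * Y t \<omega> \<partial>M)"
    using ae by (intro integral_cong_AE) auto
  finally show ?thesis by simp
qed

text \<open>On each piece of \<open>A\<close> where the rounded time is constant, the ordinary
  martingale property applies. The hypothesis on \<open>A\<close> says that \<open>A\<close> belongs
  to the past of the rounded time; it is needed both for \<open>A\<close> in the past of
  \<open>\<tau>\<close> and for level sets of the value at the rounded time.\<close>

lemma martingale_integral_grid:
  assumes Y: "martingale M F T Y" and "0 < T" and \<tau>: "\<tau> \<in> stopping_times M F T"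
    and [measurable]: "A \<in> sets M"
    and A: "\<And>j. j \<le> Suc k \<Longrightarrow> {\<omega> \<in> A. grid_index T k (\<tau> \<omega>) = j} \<in> sets (F (grid_point T k j))"
  shows "integrable M (\<lambda>\<omega>. indicator A \<omega> * Y (grid_point T k (grid_index T k (\<tau> \<omega>))) \<omega>)"
    and "(\<integral>\<omega>. indicator A \<omega> * Y (grid_point T k (grid_index T k (\<tau> \<omega>))) \<omega> \<partial>M)
      = (\<integral>\<omega>. indicator A \<omega> * Y T \<omega> \<partial>M)"
proof -
  define B where "B = (\<lambda>j. {\<omega> \<in> A. grid_index T k (\<tau> \<omega>) = j})"
  have BF: "B j \<in> sets (F (grid_point T k j))" if "j \<le> Suc k" for j
    using A[OF that] by (simp add: B_def)
  then have B: "B j \<in> sets M" if "j \<le> Suc k" for j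
    using that sets_F_subset by blast
  have int_Y: "integrable M (Y t)" if "t \<in> {0..T}" for t
    using Y that by (auto simp: martingale_def)
  have int_B: "integrable M (\<lambda>\<omega>. indicator (B j) \<omega> * Y t \<omega>)" if "j \<le> Suc k" "t \<in> {0..T}" for j t
    using integrable_mult_indicator[OF B[OF that(1)] int_Y[OF that(2)]] by simp
  have split: "indicator A \<omega> * f (grid_index T k (\<tau> \<omega>)) = (\<Sum>j\<le>Suc k. indicator (B j) \<omega> * f j)"
    if "\<omega> \<in> space M" for \<omega> and f :: "nat \<Rightarrow> real"
  proof -
    have "(\<Sum>j\<le>Suc k. indicator (B j) \<omega> * f j)
        = (\<Sum>j\<le>Suc k. if j = grid_index T k (\<tau> \<omega>) then indicator A \<omega> * f j else 0)"
      by (intro sum.cong) (auto simp: B_def indicator_def)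
    also have "\<dots> = indicator A \<omega> * f (grid_index T k (\<tau> \<omega>))"
      using grid_index_le[OF \<open>0 < T\<close> stopping_times_in[OF \<tau> that], of k] by (subst sum.delta) auto
    finally show ?thesis by simp
  qed
  have split_Y: "indicator A \<omega> * Y (grid_point T k (grid_index T k (\<tau> \<omega>))) \<omega>
      = (\<Sum>j\<le>Suc k. indicator (B j) \<omega> * Y (grid_point T k j) \<omega>)"
    and split_YT: "indicator A \<omega> * Y T \<omega> = (\<Sum>j\<le>Suc k. indicator (B j) \<omega> * Y T \<omega>)"
    if "\<omega> \<in> space M" for \<omega>
    using split[OF that, of "\<lambda>j. Y (grid_point T k j) \<omega>"] split[OF that, of "\<lambda>j. Y T \<omega>"] by simp_all
  have "integrable M (\<lambda>\<omega>. \<Sum>j\<le>Suc k. indicator (B j) \<omega> * Y (grid_point T k j) \<omega>)"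
    by (intro Bochner_Integration.integrable_sum int_B grid_point_in[OF \<open>0 < T\<close>]) auto
  then show "integrable M (\<lambda>\<omega>. indicator A \<omega> * Y (grid_point T k (grid_index T k (\<tau> \<omega>))) \<omega>)"
    by (subst Bochner_Integration.integrable_cong[OF refl split_Y]) simp_all
  have "(\<integral>\<omega>. indicator A \<omega> * Y (grid_point T k (grid_index T k (\<tau> \<omega>))) \<omega> \<partial>M)
      = (\<integral>\<omega>. (\<Sum>j\<le>Suc k. indicator (B j) \<omega> * Y (grid_point T k j) \<omega>) \<partial>M)"
    by (intro Bochner_Integration.integral_cong refl split_Y)
  also have "\<dots> = (\<Sum>j\<le>Suc k. \<integral>\<omega>. indicator (B j) \<omega> * Y (grid_point T k j) \<omega> \<partial>M)"
    by (intro Bochner_Integration.integral_sum int_B grid_point_in[OF \<open>0 < T\<close>]) auto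
  also have "\<dots> = (\<Sum>j\<le>Suc k. \<integral>\<omega>. indicator (B j) \<omega> * Y T \<omega> \<partial>M)"
    by (intro sum.cong refl martingale_integral[OF Y] BF grid_point_in[OF \<open>0 < T\<close>]) auto
  also have "\<dots> = (\<integral>\<omega>. (\<Sum>j\<le>Suc k. indicator (B j) \<omega> * Y T \<omega>) \<partial>M)"
    using \<open>0 < T\<close> by (intro Bochner_Integration.integral_sum[symmetric] int_B) auto
  also have "\<dots> = (\<integral>\<omega>. indicator A \<omega> * Y T \<omega> \<partial>M)"
    by (intro Bochner_Integration.integral_cong refl split_YT[symmetric])
  finally show "(\<integral>\<omega>. indicator A \<omega> * Y (grid_point T k (grid_index T k (\<tau> \<omega>))) \<omega> \<partial>M)
      = (\<integral>\<omega>. indicator A \<omega> * Y T \<omega> \<partial>M)" .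
qed

text \<open>As times are rounded up, index \<open>j\<close> means that \<open>\<tau>\<close> is at
  most the \<open>j\<close>-th grid point but not at most the preceding one, and both are decided at
  the \<open>j\<close>-th point.\<close>

lemma grid_index_pre_sigma:
  assumes "0 < T" and \<tau>: "\<tau> \<in> stopping_times M F T" and A: "A \<in> sets (pre_sigma \<tau>)" and j: "j \<le> Suc k"
  shows "{\<omega> \<in> A. grid_index T k (\<tau> \<omega>) = j} \<in> sets (F (grid_point T k j))"
proof -
  have le: "{\<omega> \<in> A. grid_index T k (\<tau> \<omega>) \<le> i} \<in> sets (F (grid_point T k i))" if "i \<le> Suc k" for i
    using sets_pre_sigmaD[OF stopping_timesD[OF \<tau>] A] grid_index_le_iff[OF \<open>0 < T\<close> that] by simp
  show ?thesis
  proof (cases j)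
    case 0
    then show ?thesis using le[of 0] by simp
  next
    case (Suc i)
    have "grid_point T k i \<le> grid_point T k j"
      using \<open>0 < T\<close> Suc by (auto simp: grid_point_def intro!: divide_right_mono mult_left_mono)
    then have "{\<omega> \<in> A. grid_index T k (\<tau> \<omega>) \<le> i} \<in> sets (F (grid_point T k j))"
      using le[of i] sets_F_mono j Suc by fastforce
    then have "{\<omega> \<in> A. grid_index T k (\<tau> \<omega>) \<le> j} - {\<omega> \<in> A. grid_index T k (\<tau> \<omega>) \<le> i}
        \<in> sets (F (grid_point T k j))"
      using le[OF j] by auto
    also have "{\<omega> \<in> A. grid_index T k (\<tau> \<omega>) \<le> j} - {\<omega> \<in> A. grid_index T k (\<tau> \<omega>) \<le> i}
        = {\<omega> \<in> A. grid_index T k (\<tau> \<omega>) = j}"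
      using Suc by auto
    finally show ?thesis .
  qed
qed

text \<open>Jensen's inequality for the tail function, done by hand. The right-hand side does not
  depend on \<open>k\<close>, so the values at all the rounded times have vanishing tails
  together.\<close>

lemma martingale_grid_tails:
  assumes Y: "martingale M F T Y" and "0 < T" and \<tau>: "\<tau> \<in> stopping_times M F T" and "0 \<le> C"
  shows "(\<integral>\<^sup>+\<omega>. ennreal (\<bar>Y (grid_point T k (grid_index T k (\<tau> \<omega>))) \<omega>\<bar> - C) \<partial>M)
    \<le> (\<integral>\<^sup>+\<omega>. ennreal (\<bar>Y T \<omega>\<bar> - C) \<partial>M)"
proof -
  define Z where "Z = (\<lambda>\<omega>. Y (grid_point T k (grid_index T k (\<tau> \<omega>))) \<omega>)"
  have YF: "Y t \<in> borel_measurable (F t)" and int_Y: "integrable M (Y t)" if "t \<in> {0..T}" for t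
    using Y that by (auto simp: martingale_def)
  have [measurable]: "Z \<in> borel_measurable M"
    unfolding Z_def
    by (rule borel_measurable_evaluate_grid_index[OF borel_measurable_integrable[OF int_Y] \<open>0 < T\<close>
          stopping_times_measurable[OF \<tau>]])
  have int_YT [simp]: "integrable M (Y T)"
    using int_Y \<open>0 < T\<close> by simp
  then have [measurable]: "Y T \<in> borel_measurable M"
    by (rule borel_measurable_integrable)
  have index: "{\<omega> \<in> {\<omega> \<in> space M. Z \<omega> \<in> S}. grid_index T k (\<tau> \<omega>) = j} \<in> sets (F (grid_point T k j))"
    if "j \<le> Suc k" "S \<in> sets borel" for S j
  proof -
    have "{\<omega> \<in> {\<omega> \<in> space M. Z \<omega> \<in> S}. grid_index T k (\<tau> \<omega>) = j}
        = {\<omega> \<in> space M. grid_index T k (\<tau> \<omega>) = j} \<inter> (Y (grid_point T k j) -` S \<inter> space (F (grid_point T k j)))"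
      by (auto simp: Z_def space_F)
    moreover have "{\<omega> \<in> space M. grid_index T k (\<tau> \<omega>) = j} \<in> sets (F (grid_point T k j))"
      using \<open>0 < T\<close> \<tau> that sets.top[of "pre_sigma \<tau>"]
      by (intro grid_index_pre_sigma) (auto simp: space_pre_sigma)
    moreover have "Y (grid_point T k j) -` S \<inter> space (F (grid_point T k j)) \<in> sets (F (grid_point T k j))"
      using YF grid_point_in[OF \<open>0 < T\<close>] that by (intro measurable_sets) auto
    ultimately show ?thesis by auto
  qed
  have int_Z: "integrable M (\<lambda>\<omega>. indicator {\<omega> \<in> space M. Z \<omega> \<in> S} \<omega> * Z \<omega>)"
    and integral_Z: "(\<integral>\<omega>. indicator {\<omega> \<in> space M. Z \<omega> \<in> S} \<omega> * Z \<omega> \<partial>M)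
      = (\<integral>\<omega>. indicator {\<omega> \<in> space M. Z \<omega> \<in> S} \<omega> * Y T \<omega> \<partial>M)"
    if [measurable]: "S \<in> sets borel" for S
  proof -
    have "{\<omega> \<in> space M. Z \<omega> \<in> S} \<in> sets M"
      by measurable
    from martingale_integral_grid[OF Y \<open>0 < T\<close> \<tau> this index[OF _ that]]
    show "integrable M (\<lambda>\<omega>. indicator {\<omega> \<in> space M. Z \<omega> \<in> S} \<omega> * Z \<omega>)"
      "(\<integral>\<omega>. indicator {\<omega> \<in> space M. Z \<omega> \<in> S} \<omega> * Z \<omega> \<partial>M)
        = (\<integral>\<omega>. indicator {\<omega> \<in> space M. Z \<omega> \<in> S} \<omega> * Y T \<omega> \<partial>M)"
      by (simp_all add: Z_def)
  qed
  define P where "P = {\<omega> \<in> space M. Z \<omega> \<in> {C<..}}"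
  define N where "N = {\<omega> \<in> space M. Z \<omega> \<in> {..<- C}}"
  have [measurable]: "P \<in> sets M" "N \<in> sets M"
    by (simp_all add: P_def N_def)
  have [simp]: "integrable M (\<lambda>\<omega>. indicator P \<omega> * Z \<omega>)" "integrable M (\<lambda>\<omega>. indicator N \<omega> * Z \<omega>)"
    unfolding P_def N_def by (intro int_Z; simp)+
  have [simp]: "integrable M (\<lambda>\<omega>. indicator P \<omega> * Y T \<omega>)" "integrable M (\<lambda>\<omega>. indicator N \<omega> * Y T \<omega>)"
    using integrable_mult_indicator[OF _ int_YT] by (auto simp: mult.commute)
  have [simp]: "integrable M (indicat_real P)" "integrable M (indicat_real N)"
    by (auto simp: less_top[symmetric])
  \<comment> \<open>The tail is linear in \<open>Z\<close> on the events \<open>P\<close> and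
    \<open>N\<close>, which are disjoint because \<open>0 \<le> C\<close>. Both belong to the past
    of the rounded time, so \<open>Z\<close> can be exchanged for \<open>Y T\<close> on
    them.\<close>
  have eq: "max 0 (\<bar>Z \<omega>\<bar> - C) = indicator P \<omega> * Z \<omega> - indicator N \<omega> * Z \<omega> - indicator P \<omega> * C - indicator N \<omega> * C"
    if "\<omega> \<in> space M" for \<omega>
    using that \<open>0 \<le> C\<close> by (auto simp: P_def N_def indicator_def)
  have int1: "integrable M (\<lambda>\<omega>. max 0 (\<bar>Z \<omega>\<bar> - C))"
    by (subst Bochner_Integration.integrable_cong[OF refl eq]) simp_all
  have int2: "integrable M (\<lambda>\<omega>. max 0 (\<bar>Y T \<omega>\<bar> - C))"
    by simp
  have "(\<integral>\<omega>. max 0 (\<bar>Z \<omega>\<bar> - C) \<partial>M)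
      = (\<integral>\<omega>. indicator P \<omega> * Z \<omega> - indicator N \<omega> * Z \<omega> - indicator P \<omega> * C - indicator N \<omega> * C \<partial>M)"
    by (intro Bochner_Integration.integral_cong refl eq)
  also have "\<dots> = (\<integral>\<omega>. indicator P \<omega> * Z \<omega> \<partial>M) - (\<integral>\<omega>. indicator N \<omega> * Z \<omega> \<partial>M)
      - (\<integral>\<omega>. indicator P \<omega> * C \<partial>M) - (\<integral>\<omega>. indicator N \<omega> * C \<partial>M)"
    by (simp del: Bochner_Integration.integral_mult_left integral_mult_left_zero)
  also have "\<dots> = (\<integral>\<omega>. indicator P \<omega> * Y T \<omega> \<partial>M) - (\<integral>\<omega>. indicator N \<omega> * Y T \<omega> \<partial>M)
      - (\<integral>\<omega>. indicator P \<omega> * C \<partial>M) - (\<integral>\<omega>. indicator N \<omega> * C \<partial>M)"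
    unfolding P_def N_def by (simp only: integral_Z borel_open open_lessThan open_greaterThan)
  also have "\<dots> = (\<integral>\<omega>. indicator P \<omega> * Y T \<omega> - indicator N \<omega> * Y T \<omega> - indicator P \<omega> * C - indicator N \<omega> * C \<partial>M)"
    by (simp del: Bochner_Integration.integral_mult_left integral_mult_left_zero)
  \<comment> \<open>\<open>P\<close> and \<open>N\<close> were chosen by the sign of
    \<open>Z\<close>, not of \<open>Y T\<close>, so here the expression only bounds the tail from
    below.\<close>
  also have "\<dots> \<le> (\<integral>\<omega>. max 0 (\<bar>Y T \<omega>\<bar> - C) \<partial>M)"
  proof (rule integral_mono[OF _ int2])
    fix \<omega>
    show "indicator P \<omega> * Y T \<omega> - indicator N \<omega> * Y T \<omega> - indicator P \<omega> * C - indicator N \<omega> * C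
        \<le> max 0 (\<bar>Y T \<omega>\<bar> - C)"
      using \<open>0 \<le> C\<close> by (auto simp: P_def N_def indicator_def)
  qed simp
  finally have *: "(\<integral>\<omega>. max 0 (\<bar>Z \<omega>\<bar> - C) \<partial>M) \<le> (\<integral>\<omega>. max 0 (\<bar>Y T \<omega>\<bar> - C) \<partial>M)" .
  have max0: "ennreal r = ennreal (max 0 r)" for r
    by (simp add: max_def ennreal_neg)
  have "(\<integral>\<^sup>+\<omega>. ennreal (\<bar>Z \<omega>\<bar> - C) \<partial>M) = (\<integral>\<^sup>+\<omega>. ennreal (max 0 (\<bar>Z \<omega>\<bar> - C)) \<partial>M)"
    by (intro nn_integral_cong max0)
  also have "\<dots> = ennreal (\<integral>\<omega>. max 0 (\<bar>Z \<omega>\<bar> - C) \<partial>M)"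
    by (intro nn_integral_eq_integral int1) simp
  also have "\<dots> \<le> ennreal (\<integral>\<omega>. max 0 (\<bar>Y T \<omega>\<bar> - C) \<partial>M)"
    by (intro ennreal_leI *)
  also have "\<dots> = (\<integral>\<^sup>+\<omega>. ennreal (max 0 (\<bar>Y T \<omega>\<bar> - C)) \<partial>M)"
    by (intro nn_integral_eq_integral[symmetric] int2) simp
  also have "\<dots> = (\<integral>\<^sup>+\<omega>. ennreal (\<bar>Y T \<omega>\<bar> - C) \<partial>M)"
    by (intro nn_integral_cong max0[symmetric])
  finally show ?thesis
    unfolding Z_def .
qed

text \<open>Along the grids the integral over \<open>A\<close> already has its final value; Vitali's
  theorem carries it to the limit \<open>\<tau>\<close>.\<close>

lemma martingale_optional_stopping:
  assumes Y: "martingale M F T Y" and "0 < T" and \<tau>: "\<tau> \<in> stopping_times M F T"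
    and rc: "\<And>\<omega> t. \<omega> \<in> space M \<Longrightarrow> t \<in> {0..<T} \<Longrightarrow> continuous (at_right t) (\<lambda>t. Y t \<omega>)"
    and A: "A \<in> sets (pre_sigma \<tau>)"
  shows "integrable M (\<lambda>\<omega>. Y (\<tau> \<omega>) \<omega>)"
    and "(\<integral>\<omega>. indicator A \<omega> * Y (\<tau> \<omega>) \<omega> \<partial>M) = (\<integral>\<omega>. indicator A \<omega> * Y T \<omega> \<partial>M)"
proof -
  define Z where "Z = (\<lambda>k \<omega>. Y (grid_point T k (grid_index T k (\<tau> \<omega>))) \<omega>)"
  have int_Y: "integrable M (Y t)" if "t \<in> {0..T}" for t
    using Y that by (auto simp: martingale_def)
  then have YM: "Y t \<in> borel_measurable M" if "t \<in> {0..T}" for t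
    using that by (intro borel_measurable_integrable)
  have A': "A \<in> sets M"
    using A sets_pre_sigma_subset[OF \<tau>] by auto
  have meas: "(\<lambda>\<omega>. Y (\<tau> \<omega>) \<omega>) \<in> borel_measurable M"
    by (rule borel_measurable_evaluate[OF YM \<open>0 < T\<close> rc
          stopping_times_measurable[OF \<tau>] stopping_times_in[OF \<tau>]])
  have tails: "vanishing_tails M (range Z)"
    unfolding vanishing_tails_def
  proof (intro conjI allI impI)
    show "range Z \<subseteq> borel_measurable M"
      unfolding Z_def
      using borel_measurable_evaluate_grid_index[where Z=Y, OF YM \<open>0 < T\<close>
          stopping_times_measurable[OF \<tau>]] by blast
    fix e :: real assume "0 < e"
    obtain C where C: "0 \<le> C" "(\<integral>\<^sup>+\<omega>. ennreal (\<bar>Y T \<omega>\<bar> - C) \<partial>M) \<le> ennreal e"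
      using integrable_nn_integral_tail[OF int_Y \<open>0 < e\<close>, of T] \<open>0 < T\<close> by auto
    then show "\<exists>C\<ge>0. \<forall>W\<in>range Z. (\<integral>\<^sup>+\<omega>. ennreal (\<bar>W \<omega>\<bar> - C) \<partial>M) \<le> ennreal e"
      using martingale_grid_tails[OF Y \<open>0 < T\<close> \<tau> C(1)] unfolding Z_def
      by (intro exI[of _ C]) (auto intro: order_trans)
  qed
  have lim: "AE \<omega> in M. (\<lambda>k. Z k \<omega>) \<longlonglongrightarrow> Y (\<tau> \<omega>) \<omega>"
    unfolding Z_def
    by (intro AE_I2 grid_point_index_tendsto[where f="\<lambda>t. Y t _", OF \<open>0 < T\<close>] rc stopping_times_in[OF \<tau>])
  show "integrable M (\<lambda>\<omega>. Y (\<tau> \<omega>) \<omega>)"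
    by (rule vanishing_tails_tendsto_integral(1)[OF tails meas lim A'])
  have "(\<integral>\<omega>. indicator A \<omega> * Z k \<omega> \<partial>M) = (\<integral>\<omega>. indicator A \<omega> * Y T \<omega> \<partial>M)" for k
    unfolding Z_def
    by (intro martingale_integral_grid(2)[OF Y \<open>0 < T\<close> \<tau> A'] grid_index_pre_sigma[OF \<open>0 < T\<close> \<tau> A])
  then show "(\<integral>\<omega>. indicator A \<omega> * Y (\<tau> \<omega>) \<omega> \<partial>M) = (\<integral>\<omega>. indicator A \<omega> * Y T \<omega> \<partial>M)"
    using vanishing_tails_tendsto_integral(2)[OF tails meas lim A'] by (simp add: LIMSEQ_const_iff)
qed

text \<open>Before \<open>r\<close> stopping is invisible just to the right of \<open>t\<close>;
  from \<open>r\<close> on the stopped path is constant there.\<close>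

lemma continuous_at_right_stopped:
  fixes f :: "real \<Rightarrow> real"
  assumes "continuous (at_right t) f"
  shows "continuous (at_right t) (\<lambda>s. f (min s r) - c)"
proof -
  have "((\<lambda>s. f (min s r)) \<longlongrightarrow> f (min t r)) (at_right t)"
  proof (cases "t < r")
    case True
    then have "\<forall>\<^sub>F s in at_right t. f s = f (min s r)"
      using eventually_at_right_less[of t]
      by (intro eventually_mono[OF eventually_at_right_real[OF True]]) auto
    with assms True show ?thesis
      by (auto simp: continuous_within elim: Lim_transform_eventually)
  next
    case False
    have "\<forall>\<^sub>F s in at_right t. f (min t r) = f (min s r)"
      using eventually_at_right_less[of t] False by (auto elim!: eventually_mono simp: min_def)
    then show ?thesis
      by (rule Lim_transform_eventually[OF tendsto_const])
  qed
  then show ?thesis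
    unfolding continuous_within by (intro tendsto_intros)
qed

text \<open>
  The stopped martingale differences vanish on \<open>A\<close> along the localizing sequence, and the vanishing
  tails of the values of \<open>X\<close> and \<open>V\<close> at stopping times allow to pass to the limit.
\<close>

lemma integral_increment_eq:
  assumes N: "local_martingale M F T N" and "0 < T"
    and X: "cadlag_adapted M F T X" "vanishing_tails M ((\<lambda>\<tau> \<omega>. X (\<tau> \<omega>) \<omega>) ` stopping_times M F T)"
    and V: "cadlag_adapted M F T V" "vanishing_tails M ((\<lambda>\<tau> \<omega>. V (\<tau> \<omega>) \<omega>) ` stopping_times M F T)"
    and decomp: "AE \<omega> in M. \<forall>t\<in>{0..T}. X t \<omega> = X 0 \<omega> + V t \<omega> + N t \<omega>"
    and \<tau>: "\<tau> \<in> stopping_times M F T" and \<sigma>: "\<sigma> \<in> stopping_times M F T"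
    and le: "\<And>\<omega>. \<omega> \<in> space M \<Longrightarrow> \<tau> \<omega> \<le> \<sigma> \<omega>" and A: "A \<in> sets (pre_sigma \<tau>)"
  shows "(\<integral>\<omega>. indicator A \<omega> * (X (\<sigma> \<omega>) \<omega> - X (\<tau> \<omega>) \<omega>) \<partial>M)
    = (\<integral>\<omega>. indicator A \<omega> * (V (\<sigma> \<omega>) \<omega> - V (\<tau> \<omega>) \<omega>) \<partial>M)"
proof -
  obtain \<rho> where \<rho>: "\<And>n. \<rho> n \<in> stopping_times M F T"
      "\<And>n \<omega>. \<omega> \<in> space M \<Longrightarrow> \<rho> n \<omega> \<le> \<rho> (Suc n) \<omega>" "AE \<omega> in M. \<exists>n. \<rho> n \<omega> = T"
      "\<And>n. martingale M F T (\<lambda>t \<omega>. N (min t (\<rho> n \<omega>)) \<omega> - N 0 \<omega>)"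
    using N unfolding local_martingale_def by blast
  have N': "cadlag_adapted M F T N"
    using N by (simp add: local_martingale_def)
  \<comment> \<open>An event known at \<open>\<tau>\<close> is known at the later
    \<open>\<sigma>\<close>, so optional stopping applies to \<open>A\<close> at both times.\<close>
  have A\<sigma>: "A \<in> sets (pre_sigma \<sigma>)"
    using mono_pre_sigma[OF stopping_timesD[OF \<tau>] stopping_timesD[OF \<sigma>] le] A by auto
  have A': "A \<in> sets M"
    using A sets_pre_sigma_subset[OF \<tau>] by auto
  define st where "st = (\<lambda>\<upsilon> n \<omega>. min (\<upsilon> \<omega>) (\<rho> n \<omega>))"
  have st: "st \<upsilon> n \<in> stopping_times M F T" if "\<upsilon> \<in> stopping_times M F T" for \<upsilon> n
    unfolding st_def using that \<rho>(1) by (rule stopping_times_min)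
  \<comment> \<open>Almost every path reaches \<open>T\<close> after finitely many localizing steps,
    so the sequence is eventually constant.\<close>
  have st_lim: "AE \<omega> in M. (\<lambda>n. Z (st \<upsilon> n \<omega>) \<omega>) \<longlonglongrightarrow> Z (\<upsilon> \<omega>) \<omega>"
    if "\<upsilon> \<in> stopping_times M F T" for \<upsilon> and Z :: "real \<Rightarrow> 'a \<Rightarrow> real"
    using \<rho>(3) AE_space
  proof eventually_elim
    case (elim \<omega>)
    then obtain n where n: "\<rho> n \<omega> = T" by auto
    have "st \<upsilon> m \<omega> = \<upsilon> \<omega>" if "n \<le> m" for m
    proof -
      have "\<rho> n \<omega> \<le> \<rho> m \<omega>"
        using \<rho>(2)[OF elim(2)] that by (rule lift_Suc_mono_le)
      then show ?thesis
        using n stopping_times_in[OF \<open>\<upsilon> \<in> stopping_times M F T\<close> elim(2)] by (auto simp: st_def)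
    qed
    then show ?case
      by (intro tendsto_eventually eventually_sequentiallyI[of n]) simp
  qed
  have limit: "(\<lambda>n. \<integral>\<omega>. indicator A \<omega> * Z (st \<upsilon> n \<omega>) \<omega> \<partial>M) \<longlonglongrightarrow> (\<integral>\<omega>. indicator A \<omega> * Z (\<upsilon> \<omega>) \<omega> \<partial>M)"
    and int: "integrable M (\<lambda>\<omega>. indicator A \<omega> * Z (\<upsilon> \<omega>) \<omega>)"
    if "\<upsilon> \<in> stopping_times M F T" "cadlag_adapted M F T Z"
      "vanishing_tails M ((\<lambda>\<tau> \<omega>. Z (\<tau> \<omega>) \<omega>) ` stopping_times M F T)" for \<upsilon> Z
  proof -
    have "vanishing_tails M (range (\<lambda>n \<omega>. Z (st \<upsilon> n \<omega>) \<omega>))"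
      using that(3) by (rule vanishing_tails_mono) (use st[OF that(1)] in auto)
    then show "(\<lambda>n. \<integral>\<omega>. indicator A \<omega> * Z (st \<upsilon> n \<omega>) \<omega> \<partial>M) \<longlonglongrightarrow> (\<integral>\<omega>. indicator A \<omega> * Z (\<upsilon> \<omega>) \<omega> \<partial>M)"
      by (rule vanishing_tails_tendsto_integral(2))
        (use cadlag_adapted_evaluate_measurable[OF that(2) \<open>0 < T\<close> that(1)] st_lim[OF that(1)] A' in auto)
    have "integrable M (\<lambda>\<omega>. Z (\<upsilon> \<omega>) \<omega>)"
      using that by (intro vanishing_tails_integrable) auto
    from integrable_mult_indicator[OF A' this]
    show "integrable M (\<lambda>\<omega>. indicator A \<omega> * Z (\<upsilon> \<omega>) \<omega>)"
      by simp
  qed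
  have eq: "(\<integral>\<omega>. indicator A \<omega> * X (st \<sigma> n \<omega>) \<omega> \<partial>M) - (\<integral>\<omega>. indicator A \<omega> * X (st \<tau> n \<omega>) \<omega> \<partial>M)
      = (\<integral>\<omega>. indicator A \<omega> * V (st \<sigma> n \<omega>) \<omega> \<partial>M) - (\<integral>\<omega>. indicator A \<omega> * V (st \<tau> n \<omega>) \<omega> \<partial>M)" for n
  proof -
    define Y where "Y = (\<lambda>t \<omega>. N (min t (\<rho> n \<omega>)) \<omega> - N 0 \<omega>)"
    have Y: "martingale M F T Y"
      unfolding Y_def by (rule \<rho>)
    have rc: "continuous (at_right t) (\<lambda>t. Y t \<omega>)" if "\<omega> \<in> space M" "t \<in> {0..<T}" for \<omega> t
      unfolding Y_def
      by (intro continuous_at_right_stopped cadlag_adapted_right_continuous[OF N' that])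
    note stop = martingale_optional_stopping[OF Y \<open>0 < T\<close> _ rc]
    have int_Y: "integrable M (\<lambda>\<omega>. indicator A \<omega> * Y (\<upsilon> \<omega>) \<omega>)"
      if "\<upsilon> \<in> stopping_times M F T" "A \<in> sets (pre_sigma \<upsilon>)" for \<upsilon>
      using integrable_mult_indicator[OF A' stop(1)[OF that(1) _ _ that(2)]] by simp
    \<comment> \<open>Both integrals equal that of \<open>Y T\<close> over \<open>A\<close>.\<close>
    have "(\<integral>\<omega>. indicator A \<omega> * Y (\<sigma> \<omega>) \<omega> \<partial>M) - (\<integral>\<omega>. indicator A \<omega> * Y (\<tau> \<omega>) \<omega> \<partial>M) = 0"
      using stop(2)[OF \<tau> _ _ A] stop(2)[OF \<sigma> _ _ A\<sigma>] by simp
    moreover have "(\<integral>\<omega>. indicator A \<omega> * Y (\<sigma> \<omega>) \<omega> \<partial>M) - (\<integral>\<omega>. indicator A \<omega> * Y (\<tau> \<omega>) \<omega> \<partial>M)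
        = (\<integral>\<omega>. indicator A \<omega> * Y (\<sigma> \<omega>) \<omega> - indicator A \<omega> * Y (\<tau> \<omega>) \<omega> \<partial>M)"
      by (intro Bochner_Integration.integral_diff[symmetric] int_Y \<sigma> \<tau> A A\<sigma>)
    \<comment> \<open>In the difference over the two times, the initial values \<open>X 0\<close>
      and \<open>N 0\<close> cancel.\<close>
    moreover have "\<dots> = (\<integral>\<omega>. (indicator A \<omega> * X (st \<sigma> n \<omega>) \<omega> - indicator A \<omega> * X (st \<tau> n \<omega>) \<omega>)
        - (indicator A \<omega> * V (st \<sigma> n \<omega>) \<omega> - indicator A \<omega> * V (st \<tau> n \<omega>) \<omega>) \<partial>M)"
    proof (rule integral_cong_AE)
      show "AE \<omega> in M. indicator A \<omega> * Y (\<sigma> \<omega>) \<omega> - indicator A \<omega> * Y (\<tau> \<omega>) \<omega>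
          = (indicator A \<omega> * X (st \<sigma> n \<omega>) \<omega> - indicator A \<omega> * X (st \<tau> n \<omega>) \<omega>)
        - (indicator A \<omega> * V (st \<sigma> n \<omega>) \<omega> - indicator A \<omega> * V (st \<tau> n \<omega>) \<omega>)"
        using decomp AE_space
      proof eventually_elim
        case (elim \<omega>)
        then have "X (st \<upsilon> n \<omega>) \<omega> = X 0 \<omega> + V (st \<upsilon> n \<omega>) \<omega> + N (st \<upsilon> n \<omega>) \<omega>"
          if "\<upsilon> \<in> stopping_times M F T" for \<upsilon>
          using stopping_times_in[OF st[OF that]] by blast
        from this[OF \<sigma>] this[OF \<tau>] show ?case
          by (simp add: Y_def st_def algebra_simps)
      qed
    qed (use int_Y[OF \<sigma> A\<sigma>] int_Y[OF \<tau> A] int[OF st[OF \<sigma>] X] int[OF st[OF \<tau>] X]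
        int[OF st[OF \<sigma>] V] int[OF st[OF \<tau>] V] in auto)
    moreover have "\<dots> = ((\<integral>\<omega>. indicator A \<omega> * X (st \<sigma> n \<omega>) \<omega> \<partial>M) - (\<integral>\<omega>. indicator A \<omega> * X (st \<tau> n \<omega>) \<omega> \<partial>M))
        - ((\<integral>\<omega>. indicator A \<omega> * V (st \<sigma> n \<omega>) \<omega> \<partial>M) - (\<integral>\<omega>. indicator A \<omega> * V (st \<tau> n \<omega>) \<omega> \<partial>M))"
      using int[OF st[OF \<sigma>] X] int[OF st[OF \<tau>] X] int[OF st[OF \<sigma>] V] int[OF st[OF \<tau>] V] by simp
    ultimately show ?thesis by simp
  qed
  have "(\<integral>\<omega>. indicator A \<omega> * X (\<sigma> \<omega>) \<omega> \<partial>M) - (\<integral>\<omega>. indicator A \<omega> * X (\<tau> \<omega>) \<omega> \<partial>M)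
      = (\<integral>\<omega>. indicator A \<omega> * V (\<sigma> \<omega>) \<omega> \<partial>M) - (\<integral>\<omega>. indicator A \<omega> * V (\<tau> \<omega>) \<omega> \<partial>M)"
  proof (rule LIMSEQ_unique)
    show "(\<lambda>n. (\<integral>\<omega>. indicator A \<omega> * X (st \<sigma> n \<omega>) \<omega> \<partial>M) - (\<integral>\<omega>. indicator A \<omega> * X (st \<tau> n \<omega>) \<omega> \<partial>M))
        \<longlonglongrightarrow> (\<integral>\<omega>. indicator A \<omega> * X (\<sigma> \<omega>) \<omega> \<partial>M) - (\<integral>\<omega>. indicator A \<omega> * X (\<tau> \<omega>) \<omega> \<partial>M)"
      by (intro tendsto_diff limit \<sigma> \<tau> X)
    show "(\<lambda>n. (\<integral>\<omega>. indicator A \<omega> * X (st \<sigma> n \<omega>) \<omega> \<partial>M) - (\<integral>\<omega>. indicator A \<omega> * X (st \<tau> n \<omega>) \<omega> \<partial>M))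
        \<longlonglongrightarrow> (\<integral>\<omega>. indicator A \<omega> * V (\<sigma> \<omega>) \<omega> \<partial>M) - (\<integral>\<omega>. indicator A \<omega> * V (\<tau> \<omega>) \<omega> \<partial>M)"
      unfolding eq by (intro tendsto_diff limit \<sigma> \<tau> V)
  qed
  then show ?thesis
    using int[OF \<sigma> X] int[OF \<tau> X] int[OF \<sigma> V] int[OF \<tau> V] by (simp add: right_diff_distrib)
qed

end

subsection \<open>Conditional expectations of increments\<close>

lemma (in prob_space) nn_cond_exp_finite:
  assumes "subalgebra M G" and [measurable]: "f \<in> borel_measurable M" and "(\<integral>\<^sup>+x. f x \<partial>M) < \<infinity>"
  shows "AE x in M. nn_cond_exp M G f x < \<infinity>"
proof -
  interpret sigma_finite_subalgebra M G
    using assms(1) by (rule sigma_finite_subalgebraI)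
  have "(\<integral>\<^sup>+x. nn_cond_exp M G f x \<partial>M) = (\<integral>\<^sup>+x. f x \<partial>M)"
    using nn_cond_exp_intg[of "\<lambda>_. 1" f] by simp
  then have "AE x in M. nn_cond_exp M G f x \<noteq> \<infinity>"
    using assms(3) by (intro nn_integral_PInf_AE) auto
  then show ?thesis
    by (simp add: less_top)
qed

text \<open>The equality of the integrals of \<open>Z\<close> and \<open>D\<close>, rearranged so that all terms are nonnegative.\<close>

lemma (in prob_space) nn_cond_exp_pos_part_le:
  assumes G: "subalgebra M G" and Z: "integrable M Z" and D: "integrable M D"
    and eq: "\<And>A. A \<in> sets G \<Longrightarrow> (\<integral>x. indicator A x * Z x \<partial>M) = (\<integral>x. indicator A x * D x \<partial>M)"
  shows "AE x in M. nn_cond_exp M G (\<lambda>x. ennreal (max (Z x) 0)) x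
    \<le> nn_cond_exp M G (\<lambda>x. ennreal (max (- Z x) 0)) x + nn_cond_exp M G (\<lambda>x. ennreal (max (D x) 0)) x"
proof -
  interpret sigma_finite_subalgebra M G
    using G by (rule sigma_finite_subalgebraI)
  have [measurable]: "Z \<in> borel_measurable M" "D \<in> borel_measurable M"
    using Z D by auto
  let ?pos = "\<lambda>W x. ennreal (max (W x) 0)" and ?neg = "\<lambda>W x. ennreal (max (- W x) 0)"
  have set_eq: "(\<integral>\<^sup>+x\<in>A. (?pos Z x + ?neg D x) \<partial>M) = (\<integral>\<^sup>+x\<in>A. (?neg Z x + ?pos D x) \<partial>M)" if A: "A \<in> sets G" for A
  proof -
    have A'[measurable]: "A \<in> sets M"
      using A G by (auto simp: subalgebra_def)
    have int: "integrable M (\<lambda>x. indicator A x * (max (W x) 0 + max (- W' x) 0))"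
      if "integrable M W" "integrable M W'" for W W' :: "'a \<Rightarrow> real"
    proof -
      have "integrable M (\<lambda>x. max (W x) 0 + max (- W' x) 0)"
        using that by simp
      from integrable_mult_indicator[OF A' this] show ?thesis
        by simp
    qed
    have nn: "(\<integral>\<^sup>+x\<in>A. (?pos W x + ?neg W' x) \<partial>M)
        = ennreal (\<integral>x. indicator A x * (max (W x) 0 + max (- W' x) 0) \<partial>M)"
      if "integrable M W" "integrable M W'" for W W' :: "'a \<Rightarrow> real"
    proof -
      have "(\<integral>\<^sup>+x\<in>A. (?pos W x + ?neg W' x) \<partial>M)
          = (\<integral>\<^sup>+x. ennreal (indicator A x * (max (W x) 0 + max (- W' x) 0)) \<partial>M)"
        by (intro nn_integral_cong) (simp add: ennreal_plus[of "max _ 0" "max _ 0"] indicator_def)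
      also have "\<dots> = ennreal (\<integral>x. indicator A x * (max (W x) 0 + max (- W' x) 0) \<partial>M)"
        by (intro nn_integral_eq_integral int that AE_I2) auto
      finally show ?thesis .
    qed
    have "(\<integral>x. indicator A x * (max (Z x) 0 + max (- D x) 0) \<partial>M) - (\<integral>x. indicator A x * (max (D x) 0 + max (- Z x) 0) \<partial>M)
        = (\<integral>x. indicator A x * (max (Z x) 0 + max (- D x) 0) - indicator A x * (max (D x) 0 + max (- Z x) 0) \<partial>M)"
      by (intro Bochner_Integration.integral_diff[symmetric] int Z D)
    also have "\<dots> = (\<integral>x. indicator A x * Z x - indicator A x * D x \<partial>M)"
      by (intro Bochner_Integration.integral_cong refl) (auto simp: max_def algebra_simps)
    also have "\<dots> = (\<integral>x. indicator A x * Z x \<partial>M) - (\<integral>x. indicator A x * D x \<partial>M)"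
      using integrable_mult_indicator[OF A' Z] integrable_mult_indicator[OF A' D] by simp
    also have "\<dots> = 0"
      using eq[OF A] by simp
    finally show ?thesis
      using nn[OF Z D] nn[OF D Z] by (simp add: add.commute)
  qed
  \<comment> \<open>Equal integrals over all sets of \<open>G\<close> determine the conditional
    expectation. Then the negative part of \<open>D\<close> is dropped on one side, and the sum is
    split on the other.\<close>
  have "AE x in M. nn_cond_exp M G (\<lambda>x. ?neg Z x + ?pos D x) x = nn_cond_exp M G (\<lambda>x. ?pos Z x + ?neg D x) x"
  proof (rule nn_cond_exp_charact)
    fix A assume A: "A \<in> sets G"
    have "(\<integral>\<^sup>+x\<in>A. nn_cond_exp M G (\<lambda>x. ?neg Z x + ?pos D x) x \<partial>M) = (\<integral>\<^sup>+x\<in>A. (?neg Z x + ?pos D x) \<partial>M)"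
      using nn_cond_exp_intg[of "indicator A" "\<lambda>x. ?neg Z x + ?pos D x"] A by (simp add: mult.commute)
    then show "(\<integral>\<^sup>+x\<in>A. (?pos Z x + ?neg D x) \<partial>M) = (\<integral>\<^sup>+x\<in>A. nn_cond_exp M G (\<lambda>x. ?neg Z x + ?pos D x) x \<partial>M)"
      using set_eq[OF A] by simp
  qed auto
  moreover have "AE x in M. nn_cond_exp M G (?neg Z) x + nn_cond_exp M G (?pos D) x
      = nn_cond_exp M G (\<lambda>x. ?neg Z x + ?pos D x) x"
    by (rule nn_cond_exp_sum) auto
  moreover have "AE x in M. nn_cond_exp M G (?pos Z) x \<le> nn_cond_exp M G (\<lambda>x. ?pos Z x + ?neg D x) x"
    by (rule nn_cond_exp_mono) auto
  ultimately show ?thesis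
    by eventually_elim simp
qed

text \<open>Finiteness of \<open>a\<close> is essential: in \<open>ereal\<close> the difference
  \<open>\<infinity> - \<infinity>\<close> is \<open>\<infinity>\<close>, while
  \<open>a \<le> b + c\<close> says nothing about \<open>c\<close> when \<open>b\<close> is
  infinite.\<close>

lemma e2ennreal_max_diff_le:
  assumes "a \<le> b + c" "a < \<infinity>"
  shows "e2ennreal (max 0 (enn2ereal a - enn2ereal b)) \<le> c"
proof (cases a; cases b; cases c)
  fix r s t :: real
  assume *: "0 \<le> r" "a = ennreal r" "0 \<le> s" "b = ennreal s" "0 \<le> t" "c = ennreal t"
  then have "r \<le> s + t"
    using assms(1) by (simp flip: ennreal_plus)
  have "max 0 (enn2ereal a - enn2ereal b) = ereal (max 0 (r - s))"
    using * by (simp add: enn2ereal_ennreal max_def)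
  then have "e2ennreal (max 0 (enn2ereal a - enn2ereal b)) = ennreal (max 0 (r - s))"
    by (simp only: e2ennreal_ereal)
  also have "\<dots> \<le> c"
    using * \<open>r \<le> s + t\<close> by (auto intro!: ennreal_leI)
  finally show ?thesis .
qed (use assms in \<open>auto simp: max_def\<close>)

text \<open>\<open>Y\<close> may fail to be integrable, but \<open>Y \<le> Z\<close> bounds its
  positive part by that of \<open>Z\<close> and makes its negative part only larger. So the
  conditional expectation of the positive part is finite, and infinity of the negative part does no
  harm.\<close>

lemma (in prob_space) ext_cond_exp_pos_le:
  assumes G: "subalgebra M G" and Z: "integrable M Z" and D: "integrable M D"
    and eq: "\<And>A. A \<in> sets G \<Longrightarrow> (\<integral>x. indicator A x * Z x \<partial>M) = (\<integral>x. indicator A x * D x \<partial>M)"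
    and Y[measurable]: "Y \<in> borel_measurable M" and le: "AE x in M. Y x \<le> Z x"
  shows "AE x in M. e2ennreal (max 0 (ext_cond_exp M G Y x)) \<le> nn_cond_exp M G (\<lambda>x. ennreal (max (D x) 0)) x"
proof -
  interpret sigma_finite_subalgebra M G
    using G by (rule sigma_finite_subalgebraI)
  have [measurable]: "Z \<in> borel_measurable M"
    using Z by auto
  have "(\<integral>\<^sup>+x. ennreal (max (Z x) 0) \<partial>M) = ennreal (\<integral>x. max (Z x) 0 \<partial>M)"
    using Z by (intro nn_integral_eq_integral) auto
  then have "AE x in M. nn_cond_exp M G (\<lambda>x. ennreal (max (Z x) 0)) x < \<infinity>"
    by (intro nn_cond_exp_finite G) auto
  moreover have "AE x in M. nn_cond_exp M G (\<lambda>x. ennreal (max (Y x) 0)) x \<le> nn_cond_exp M G (\<lambda>x. ennreal (max (Z x) 0)) x"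
    using le by (intro nn_cond_exp_mono, eventually_elim) (auto intro!: ennreal_leI)
  moreover have "AE x in M. nn_cond_exp M G (\<lambda>x. ennreal (max (- Z x) 0)) x \<le> nn_cond_exp M G (\<lambda>x. ennreal (max (- Y x) 0)) x"
    using le by (intro nn_cond_exp_mono, eventually_elim) (auto intro!: ennreal_leI)
  moreover have "AE x in M. nn_cond_exp M G (\<lambda>x. ennreal (max (Z x) 0)) x
      \<le> nn_cond_exp M G (\<lambda>x. ennreal (max (- Z x) 0)) x + nn_cond_exp M G (\<lambda>x. ennreal (max (D x) 0)) x"
    by (rule nn_cond_exp_pos_part_le[OF G Z D]) (rule eq)
  ultimately show ?thesis
    unfolding ext_cond_exp_def
    by eventually_elim (intro e2ennreal_max_diff_le, auto intro: order_trans add_right_mono)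
qed

lemma (in prob_space) ext_cond_exp_neg_le:
  assumes G: "subalgebra M G" and Z: "integrable M Z" and D: "integrable M D"
    and eq: "\<And>A. A \<in> sets G \<Longrightarrow> (\<integral>x. indicator A x * Z x \<partial>M) = (\<integral>x. indicator A x * D x \<partial>M)"
    and Y[measurable]: "Y \<in> borel_measurable M" and le: "AE x in M. Z x \<le> Y x"
  shows "AE x in M. e2ennreal (max 0 (- ext_cond_exp M G Y x)) \<le> nn_cond_exp M G (\<lambda>x. ennreal (max (- D x) 0)) x"
proof -
  have upper: "AE x in M. e2ennreal (max 0 (ext_cond_exp M G (\<lambda>x. - Y x) x))
      \<le> nn_cond_exp M G (\<lambda>x. ennreal (max (- D x) 0)) x"
    using Z D eq le by (intro ext_cond_exp_pos_le[where Z="\<lambda>x. - Z x"] G) auto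
  \<comment> \<open>Only an inequality: if both are infinite, the left side is
    \<open>- \<infinity>\<close> and the right side is \<open>\<infinity>\<close>.\<close>
  have "- (enn2ereal a - enn2ereal b) \<le> enn2ereal b - enn2ereal a" for a b
    by (cases a; cases b) (auto simp: enn2ereal_ennreal)
  then have "max 0 (- ext_cond_exp M G Y x) \<le> max 0 (ext_cond_exp M G (\<lambda>x. - Y x) x)" for x
    unfolding ext_cond_exp_def minus_minus by (intro max.mono order_refl)
  then have neg: "e2ennreal (max 0 (- ext_cond_exp M G Y x)) \<le> e2ennreal (max 0 (ext_cond_exp M G (\<lambda>x. - Y x) x))" for x
    by (intro e2ennreal_mono)
  show ?thesis
    using upper by eventually_elim (rule order_trans[OF neg])
qed

subsection \<open>Mean co-variation and total variation\<close>

lemma sum_increments_le_total_variation: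
  assumes "(n, s) \<in> chains t"
  shows "(\<Sum>i<n. ennreal (max (f (s (Suc i)) - f (s i)) 0) + ennreal (max (- (f (s (Suc i)) - f (s i))) 0))
    \<le> total_variation f t"
  unfolding total_variation_def pos_variation_def neg_variation_def sum.distrib
  using assms by (intro add_mono) (auto intro: SUP_upper2)

lemma increment_le_total_variation:
  assumes "t \<in> {0..T}"
  shows "ennreal \<bar>f t - f 0\<bar> \<le> total_variation f T"
proof -
  have "(1, \<lambda>i. if i = 0 then 0 else t) \<in> chains T"
    using assms by (auto simp: chains_def)
  from sum_increments_le_total_variation[OF this, of f] show ?thesis
    by (auto simp: max_def abs_if ennreal_neg split: if_splits)
qed

context usual_filtered_prob_space
begin

section \<open>Uniform integrability of the processes and the bound on the mean co-variation\<close>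

text \<open>The total variation controls only increments, and \<open>V 0\<close> vanishes merely
  almost surely; so \<open>V t - V 0\<close> is dominated first. Its integrable bound serves all
  stopping times at once.\<close>

lemma fv_process_vanishing_tails:
  assumes V: "fv_process M F T V" "AE \<omega> in M. V 0 \<omega> = 0" and "0 < T" "1 \<le> p"
    and fin: "(\<integral>\<^sup>+\<omega>. epowr (total_variation (\<lambda>t. V t \<omega>) T) p \<partial>M) < \<infinity>"
  shows "vanishing_tails M ((\<lambda>\<tau> \<omega>. V (\<tau> \<omega>) \<omega>) ` stopping_times M F T)"
proof -
  have ca: "cadlag_adapted M F T V"
    using V by (simp add: fv_process_def)
  have "\<exists>B. integrable M B \<and> (AE \<omega> in M. \<forall>t\<in>{0..T}. \<bar>V t \<omega> - V 0 \<omega>\<bar> \<le> B \<omega>)"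
  proof (rule right_continuous_dominated[OF prob_space_axioms _ \<open>0 < T\<close> _ _ fin])
    show "(\<lambda>\<omega>. V t \<omega> - V 0 \<omega>) \<in> borel_measurable M" if "t \<in> {0..T}" for t
      using that \<open>0 < T\<close> by (intro borel_measurable_diff cadlag_adapted_measurable[OF ca]) auto
    show "continuous (at_right t) (\<lambda>t. V t \<omega> - V 0 \<omega>)" if "\<omega> \<in> space M" "t \<in> {0..<T}" for \<omega> t
      by (intro continuous_intros cadlag_adapted_right_continuous[OF ca that])
    show "ennreal \<bar>V t \<omega> - V 0 \<omega>\<bar> \<le> 1 + epowr (total_variation (\<lambda>t. V t \<omega>) T) p" if "t \<in> {0..T}" for \<omega> t
      using increment_le_total_variation[OF that, of "\<lambda>t. V t \<omega>"] le_one_plus_epowr[OF \<open>1 \<le> p\<close>]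
      by (rule order_trans)
  qed
  then obtain B where B: "integrable M B" "AE \<omega> in M. \<forall>t\<in>{0..T}. \<bar>V t \<omega> - V 0 \<omega>\<bar> \<le> B \<omega>"
    by auto
  show ?thesis
  proof (rule vanishing_tails_dominated[OF B(1)])
    fix Y assume "Y \<in> (\<lambda>\<tau> \<omega>. V (\<tau> \<omega>) \<omega>) ` stopping_times M F T"
    then obtain \<tau> where \<tau>: "\<tau> \<in> stopping_times M F T" "Y = (\<lambda>\<omega>. V (\<tau> \<omega>) \<omega>)"
      by auto
    show "AE \<omega> in M. \<bar>Y \<omega>\<bar> \<le> B \<omega>"
      using B(2) V(2) AE_space
    proof eventually_elim
      case (elim \<omega>)
      then show ?case
        using stopping_times_in[OF \<tau>(1) elim(3)] by (auto simp: \<tau>(2))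
    qed
  qed (use cadlag_adapted_evaluate_measurable[OF ca \<open>0 < T\<close>] in auto)
qed

lemma Sp_norm_vanishing_tails:
  assumes X: "cadlag_adapted M F T X" and "0 < T" "1 \<le> p" and norm: "Sp_norm M T p X < \<infinity>"
  shows "vanishing_tails M ((\<lambda>\<tau> \<omega>. X (\<tau> \<omega>) \<omega>) ` stopping_times M F T)"
proof -
  have fin: "(\<integral>\<^sup>+\<omega>. (SUP t\<in>{0..T}. epowr (ennreal \<bar>X t \<omega>\<bar>) p) \<partial>M) < \<infinity>"
    using norm by (simp only: Sp_norm_def epowr_less_top)
  have "\<exists>B. integrable M B \<and> (AE \<omega> in M. \<forall>t\<in>{0..T}. \<bar>X t \<omega>\<bar> \<le> B \<omega>)"
  proof (rule right_continuous_dominated[OF prob_space_axioms cadlag_adapted_measurable[OF X] \<open>0 < T\<close>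
        cadlag_adapted_right_continuous[OF X] _ fin])
    show "ennreal \<bar>X t \<omega>\<bar> \<le> 1 + (SUP t\<in>{0..T}. epowr (ennreal \<bar>X t \<omega>\<bar>) p)" if "t \<in> {0..T}" for t \<omega>
      using le_one_plus_epowr[OF \<open>1 \<le> p\<close>] by (rule order_trans) (intro add_left_mono SUP_upper that)
  qed
  then obtain B where B: "integrable M B" "AE \<omega> in M. \<forall>t\<in>{0..T}. \<bar>X t \<omega>\<bar> \<le> B \<omega>"
    by auto
  show ?thesis
  proof (rule vanishing_tails_dominated[OF B(1)])
    fix Y assume "Y \<in> (\<lambda>\<tau> \<omega>. X (\<tau> \<omega>) \<omega>) ` stopping_times M F T"
    then obtain \<tau> where \<tau>: "\<tau> \<in> stopping_times M F T" "Y = (\<lambda>\<omega>. X (\<tau> \<omega>) \<omega>)"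
      by auto
    show "AE \<omega> in M. \<bar>Y \<omega>\<bar> \<le> B \<omega>"
      using B(2) AE_space by eventually_elim (use stopping_times_in[OF \<tau>(1)] \<tau>(2) in auto)
  qed (use cadlag_adapted_evaluate_measurable[OF X \<open>0 < T\<close>] in auto)
qed

lemma mean_covariation_le_total_variation:
  assumes "0 < T" "1 \<le> p"
    and L: "cadlag_adapted M F T L" and U: "cadlag_adapted M F T U"
    and between: "AE \<omega> in M. \<forall>t\<in>{0..T}. L t \<omega> \<le> X t \<omega> \<and> X t \<omega> \<le> U t \<omega>"
    and X: "cadlag_adapted M F T X" "vanishing_tails M ((\<lambda>\<tau> \<omega>. X (\<tau> \<omega>) \<omega>) ` stopping_times M F T)"
    and V: "cadlag_adapted M F T V" "vanishing_tails M ((\<lambda>\<tau> \<omega>. V (\<tau> \<omega>) \<omega>) ` stopping_times M F T)"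
    and N: "local_martingale M F T N"
    and decomp: "AE \<omega> in M. \<forall>t\<in>{0..T}. X t \<omega> = X 0 \<omega> + V t \<omega> + N t \<omega>"
  shows "mean_covariation M F T p L U
    \<le> ennreal (p powr p) * (\<integral>\<^sup>+\<omega>. epowr (total_variation (\<lambda>t. V t \<omega>) T) p \<partial>M)"
  unfolding mean_covariation_def
proof (intro SUP_least, clarify)
  fix n \<tau> assume "(n, \<tau>) \<in> random_partitions M F T"
  then have \<tau>: "\<And>i. i \<le> n \<Longrightarrow> \<tau> i \<in> stopping_times M F T"
    and ends: "\<And>\<omega>. \<omega> \<in> space M \<Longrightarrow> \<tau> 0 \<omega> = 0" "\<And>\<omega>. \<omega> \<in> space M \<Longrightarrow> \<tau> n \<omega> = T"
    and step: "\<And>i \<omega>. \<omega> \<in> space M \<Longrightarrow> i < n \<Longrightarrow> \<tau> i \<omega> \<le> \<tau> (Suc i) \<omega>"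
    by (auto simp: random_partitions_def)
  have \<tau>_mono: "\<tau> i \<omega> \<le> \<tau> j \<omega>" if "i \<le> j" "j \<le> n" "\<omega> \<in> space M" for i j \<omega>
    using that(1,2)
  proof (induction j rule: dec_induct)
    case (step j)
    then show ?case
      using assms \<open>\<And>i \<omega>. \<omega> \<in> space M \<Longrightarrow> i < n \<Longrightarrow> \<tau> i \<omega> \<le> \<tau> (Suc i) \<omega>\<close>[OF that(3), of j] by simp
  qed simp
  define D where "D = (\<lambda>i \<omega>. V (\<tau> (Suc i) \<omega>) \<omega> - V (\<tau> i \<omega>) \<omega>)"
  \<comment> \<open>This is the absolute increment, split because the two parts have different
    origins: the positive part bounds the term with \<open>L - U\<close>, the negative part the term
    with \<open>U - L\<close>.\<close>
  define \<xi> where "\<xi> = (\<lambda>i \<omega>. ennreal (max (D i \<omega>) 0) + ennreal (max (- D i \<omega>) 0))"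
  define t where "t = (\<lambda>i \<omega>. e2ennreal (max 0 (ext_cond_exp M (pre_sigma (\<tau> i))
      (\<lambda>x. L (\<tau> (Suc i) x) x - U (\<tau> i x) x) \<omega>)) +
    e2ennreal (max 0 (- ext_cond_exp M (pre_sigma (\<tau> i)) (\<lambda>x. U (\<tau> (Suc i) x) x - L (\<tau> i x) x) \<omega>)))"
  have int: "integrable M (\<lambda>\<omega>. Z (\<tau> i \<omega>) \<omega>)"
    if "vanishing_tails M ((\<lambda>\<tau> \<omega>. Z (\<tau> \<omega>) \<omega>) ` stopping_times M F T)" "i \<le> n" for Z i
    using that \<tau> by (intro vanishing_tails_integrable[OF that(1)]) auto
  have int_D: "integrable M (D i)" if "i < n" for i
    unfolding D_def using that by (intro Bochner_Integration.integrable_diff int V) auto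
  have D_meas [measurable]: "D i \<in> borel_measurable M" if "i < n" for i
    using int_D[OF that] by (rule borel_measurable_integrable)
  have \<xi>_meas: "\<xi> i \<in> borel_measurable M" if "i < n" for i
    unfolding \<xi>_def using D_meas[OF that] by measurable
  have "AE \<omega> in M. t i \<omega> \<le> nn_cond_exp M (pre_sigma (\<tau> i)) (\<xi> i) \<omega>" if i: "i < n" for i
  proof -
    let ?G = "pre_sigma (\<tau> i)"
    let ?Z = "\<lambda>\<omega>. X (\<tau> (Suc i) \<omega>) \<omega> - X (\<tau> i \<omega>) \<omega>"
    have \<tau>i: "\<tau> i \<in> stopping_times M F T" "\<tau> (Suc i) \<in> stopping_times M F T"
      using \<tau> i by auto
    have G: "subalgebra M ?G"
      by (rule subalgebra_pre_sigma[OF \<tau>i(1)])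
    interpret sigma_finite_subalgebra M ?G
      using G by (rule sigma_finite_subalgebraI)
    note measurable = cadlag_adapted_evaluate_measurable[OF _ \<open>0 < T\<close>]
    have int_Z: "integrable M ?Z"
      using i by (intro Bochner_Integration.integrable_diff int X) auto
    have eq: "(\<integral>\<omega>. indicator A \<omega> * ?Z \<omega> \<partial>M) = (\<integral>\<omega>. indicator A \<omega> * D i \<omega> \<partial>M)" if "A \<in> sets ?G" for A
      unfolding D_def
      by (rule integral_increment_eq[OF N \<open>0 < T\<close> X V decomp \<tau>i step[OF _ i] that])
    have "AE \<omega> in M. e2ennreal (max 0 (ext_cond_exp M ?G (\<lambda>x. L (\<tau> (Suc i) x) x - U (\<tau> i x) x) \<omega>))
        \<le> nn_cond_exp M ?G (\<lambda>\<omega>. ennreal (max (D i \<omega>) 0)) \<omega>"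
    proof (rule ext_cond_exp_pos_le[OF G int_Z int_D[OF i]])
      show "AE \<omega> in M. L (\<tau> (Suc i) \<omega>) \<omega> - U (\<tau> i \<omega>) \<omega> \<le> ?Z \<omega>"
        using between AE_space
      proof eventually_elim
        case (elim \<omega>)
        then show ?case
          using stopping_times_in[OF \<tau>i(1) elim(2)] stopping_times_in[OF \<tau>i(2) elim(2)] by (intro diff_mono) auto
      qed
    qed (rule eq | assumption | intro borel_measurable_diff measurable L U \<tau>i)+
    moreover have "AE \<omega> in M. e2ennreal (max 0 (- ext_cond_exp M ?G (\<lambda>x. U (\<tau> (Suc i) x) x - L (\<tau> i x) x) \<omega>))
        \<le> nn_cond_exp M ?G (\<lambda>\<omega>. ennreal (max (- D i \<omega>) 0)) \<omega>"
    proof (rule ext_cond_exp_neg_le[OF G int_Z int_D[OF i]])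
      show "AE \<omega> in M. ?Z \<omega> \<le> U (\<tau> (Suc i) \<omega>) \<omega> - L (\<tau> i \<omega>) \<omega>"
        using between AE_space
      proof eventually_elim
        case (elim \<omega>)
        then show ?case
          using stopping_times_in[OF \<tau>i(1) elim(2)] stopping_times_in[OF \<tau>i(2) elim(2)] by (intro diff_mono) auto
      qed
    qed (rule eq | assumption | intro borel_measurable_diff measurable L U \<tau>i)+
    moreover have "AE \<omega> in M. nn_cond_exp M ?G (\<lambda>\<omega>. ennreal (max (D i \<omega>) 0)) \<omega>
        + nn_cond_exp M ?G (\<lambda>\<omega>. ennreal (max (- D i \<omega>) 0)) \<omega> = nn_cond_exp M ?G (\<xi> i) \<omega>"
      unfolding \<xi>_def using D_meas[OF i] by (intro nn_cond_exp_sum) auto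
    ultimately show ?thesis
      unfolding t_def
    proof eventually_elim
      case (elim \<omega>)
      then show ?case
        using add_mono[OF elim(1,2)] by simp
    qed
  qed
  then have "AE \<omega> in M. \<forall>i\<in>{..<n}. t i \<omega> \<le> nn_cond_exp M (pre_sigma (\<tau> i)) (\<xi> i) \<omega>"
    by (intro AE_finite_allI) auto
  then have "AE \<omega> in M. epowr (\<Sum>i<n. t i \<omega>) p
      \<le> epowr (\<Sum>i<n. nn_cond_exp M (pre_sigma (\<tau> i)) (\<xi> i) \<omega>) p"
    by eventually_elim (use \<open>1 \<le> p\<close> in \<open>auto intro!: epowr_mono sum_mono\<close>)
  then have "(\<integral>\<^sup>+\<omega>. epowr (\<Sum>i<n. t i \<omega>) p \<partial>M)
      \<le> (\<integral>\<^sup>+\<omega>. epowr (\<Sum>i<n. nn_cond_exp M (pre_sigma (\<tau> i)) (\<xi> i) \<omega>) p \<partial>M)"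
    by (rule nn_integral_mono_AE)
  also have "\<dots> \<le> ennreal (p powr p) * (\<integral>\<^sup>+\<omega>. epowr (\<Sum>i<n. \<xi> i \<omega>) p \<partial>M)"
    using \<open>1 \<le> p\<close>
  proof (rule nn_integral_sum_nn_cond_exp_powr)
    show "subalgebra M (pre_sigma (\<tau> i))" if "i < n" for i
      using \<tau>[of i] that by (intro subalgebra_pre_sigma) auto
    show "sets (pre_sigma (\<tau> i)) \<subseteq> sets (pre_sigma (\<tau> j))" if "i \<le> j" "j < n" for i j
      using that by (intro mono_pre_sigma stopping_timesD[OF \<tau>] \<tau>_mono) auto
  qed (rule \<xi>_meas)
  also have "\<dots> \<le> ennreal (p powr p) * (\<integral>\<^sup>+\<omega>. epowr (total_variation (\<lambda>t. V t \<omega>) T) p \<partial>M)"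
  proof (intro mult_left_mono nn_integral_mono epowr_mono)
    fix \<omega> assume \<omega>: "\<omega> \<in> space M"
    \<comment> \<open>On a fixed path the random partition is an ordinary one.\<close>
    have "(n, \<lambda>i. \<tau> i \<omega>) \<in> chains T"
      using ends[OF \<omega>] step[OF \<omega>] by (auto simp: chains_def)
    from sum_increments_le_total_variation[OF this, of "\<lambda>t. V t \<omega>"]
    show "(\<Sum>i<n. \<xi> i \<omega>) \<le> total_variation (\<lambda>t. V t \<omega>) T"
      by (simp add: \<xi>_def D_def)
  qed (use \<open>1 \<le> p\<close> in auto)
  finally show "(\<integral>\<^sup>+\<omega>. epowr (\<Sum>i<n. e2ennreal (max 0 (ext_cond_exp M (pre_sigma (\<tau> i))
      (\<lambda>x. L (\<tau> (Suc i) x) x - U (\<tau> i x) x) \<omega>)) +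
    e2ennreal (max 0 (- ext_cond_exp M (pre_sigma (\<tau> i)) (\<lambda>x. U (\<tau> (Suc i) x) x - L (\<tau> i x) x) \<omega>))) p \<partial>M)
    \<le> ennreal (p powr p) * (\<integral>\<^sup>+\<omega>. epowr (total_variation (\<lambda>t. V t \<omega>) T) p \<partial>M)"
    unfolding t_def .
qed

lemma mean_covariation_le_fv_part:
  assumes "0 < T" "1 \<le> p"
    and L: "cadlag_adapted M F T L" and U: "cadlag_adapted M F T U"
    and X: "X \<in> Hp_space M F T p"
    and between: "AE \<omega> in M. \<forall>t\<in>{0..T}. L t \<omega> \<le> X t \<omega> \<and> X t \<omega> \<le> U t \<omega>"
  shows "mean_covariation M F T p L U
    \<le> ennreal (p powr p) * (\<integral>\<^sup>+\<omega>. epowr (total_variation (\<lambda>t. fv_part M F T X t \<omega>) T) p \<partial>M)"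
proof -
  define V where "V = fv_part M F T X"
  \<comment> \<open>The bound holds for the finite variation part of any canonical decomposition, so
    it is enough that the chosen one belongs to some decomposition.\<close>
  have "\<exists>V N. canonical_decomposition M F T X V N"
    using X by (auto simp: Hp_space_def)
  then have "\<exists>N. canonical_decomposition M F T X V N"
    unfolding V_def fv_part_def by (rule someI_ex)
  then obtain N where N: "canonical_decomposition M F T X V N" ..
  have norm: "Hp_norm M F T p X < \<infinity>" and X_cadlag: "cadlag_adapted M F T X"
    using X by (auto simp: Hp_space_def)
  have V_cadlag: "cadlag_adapted M F T V" and V_fv: "fv_process M F T V" "AE \<omega> in M. V 0 \<omega> = 0"
    using N by (auto simp: canonical_decomposition_def fv_process_def)
  have fin: "(\<integral>\<^sup>+\<omega>. epowr (total_variation (\<lambda>t. V t \<omega>) T) p \<partial>M) < \<infinity>"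
  proof (cases "1 < p")
    case True
    then have "epowr (\<integral>\<^sup>+\<omega>. epowr (total_variation (\<lambda>t. V t \<omega>) T) p \<partial>M) (1 / p) < \<infinity>"
      using norm by (simp add: Hp_norm_def V_def Let_def)
    then show ?thesis
      by (simp only: epowr_less_top)
  next
    case False
    then have "p = 1"
      using \<open>1 \<le> p\<close> by simp
    then show ?thesis
      using norm by (simp add: Hp_norm_def V_def Let_def)
  qed
  have X_tails: "vanishing_tails M ((\<lambda>\<tau> \<omega>. X (\<tau> \<omega>) \<omega>) ` stopping_times M F T)"
  proof (cases "1 < p")
    case True
    then have "Sp_norm M T p X < \<infinity>"
      using norm by (simp add: Hp_norm_def Let_def)
    then show ?thesis
      by (rule Sp_norm_vanishing_tails[OF X_cadlag \<open>0 < T\<close> \<open>1 \<le> p\<close>])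
  next
    case False
    \<comment> \<open>For \<open>p = 1\<close> a finite norm bounds only the first moments of the
      values at stopping times; uniform integrability comes from class (D).\<close>
    then have "X \<in> D1_space M F T"
      using X \<open>1 \<le> p\<close> by (auto simp: Hp_space_def)
    then show ?thesis
      by (intro uniformly_integrable_imp_vanishing_tails) (simp add: D1_space_def class_D_def)
  qed
  show ?thesis
    unfolding V_def[symmetric]
    by (rule mean_covariation_le_total_variation[OF assms(1,2) L U between X_cadlag X_tails V_cadlag
          fv_process_vanishing_tails[OF V_fv assms(1,2) fin]])
      (use N in \<open>auto simp: canonical_decomposition_def\<close>)
qed

end

subsection \<open>Comparison of the norms\<close>

lemma Sp_norm_mono_AE:
  assumes "0 < p" "AE \<omega> in M. \<forall>t\<in>{0..T}. \<bar>Y t \<omega>\<bar> \<le> \<bar>X t \<omega>\<bar>"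
  shows "Sp_norm M T p Y \<le> Sp_norm M T p X"
  unfolding Sp_norm_def
proof (intro epowr_mono nn_integral_mono_AE)
  show "AE \<omega> in M. (SUP t\<in>{0..T}. epowr (ennreal \<bar>Y t \<omega>\<bar>) p) \<le> (SUP t\<in>{0..T}. epowr (ennreal \<bar>X t \<omega>\<bar>) p)"
    using assms(2)
    by eventually_elim (use assms(1) in \<open>auto intro!: SUP_mono epowr_mono ennreal_leI\<close>)
qed (use assms(1) in auto)

lemma D1_norm_mono_AE:
  assumes "AE \<omega> in M. \<forall>t\<in>{0..T}. \<bar>Y t \<omega>\<bar> \<le> \<bar>X t \<omega>\<bar>"
  shows "D1_norm M F T Y \<le> D1_norm M F T X"
  unfolding D1_norm_def
proof (intro SUP_mono bexI)
  fix \<tau> assume \<tau>: "\<tau> \<in> stopping_times M F T"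
  have "AE \<omega> in M. ennreal \<bar>Y (\<tau> \<omega>) \<omega>\<bar> \<le> ennreal \<bar>X (\<tau> \<omega>) \<omega>\<bar>"
    using assms AE_space by eventually_elim (use \<tau> in \<open>auto simp: stopping_times_def intro!: ennreal_leI\<close>)
  then show "(\<integral>\<^sup>+\<omega>. ennreal \<bar>Y (\<tau> \<omega>) \<omega>\<bar> \<partial>M) \<le> (\<integral>\<^sup>+\<omega>. ennreal \<bar>X (\<tau> \<omega>) \<omega>\<bar> \<partial>M)"
    by (rule nn_integral_mono_AE)
qed auto

theorem theorem4p3:
  fixes M :: "'a measure" and F :: "real \<Rightarrow> 'a measure" and T p :: real
    and L U X :: "real \<Rightarrow> 'a \<Rightarrow> real"
  assumes "usual_filtered_prob_space M F" and "0 < T" and "1 \<le> p"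
    and "cadlag_adapted M F T L" and "cadlag_adapted M F T U"
    and "AE \<omega> in M. \<forall>t\<in>{0..T}. L t \<omega> \<le> U t \<omega>"
    and "X \<in> Hp_space M F T p"
    and "AE \<omega> in M. \<forall>t\<in>{0..T}. L t \<omega> \<le> X t \<omega> \<and> X t \<omega> \<le> U t \<omega>"
  shows "(1 < p \<longrightarrow>
            Sp_norm M T p (\<lambda>t \<omega>. max (L t \<omega>) 0) + Sp_norm M T p (\<lambda>t \<omega>. max (- U t \<omega>) 0)
              + epowr (mean_covariation M F T p L U) (1 / p)
            \<le> ennreal (max 2 p) * Hp_norm M F T p X) \<and>
         (p = 1 \<longrightarrow>
            D1_norm M F T (\<lambda>t \<omega>. max (L t \<omega>) 0) + D1_norm M F T (\<lambda>t \<omega>. max (- U t \<omega>) 0)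
              + mean_covariation M F T 1 L U
            \<le> 2 * Hp_norm M F T 1 X)"
proof -
  interpret usual_filtered_prob_space M F
    by fact
  define E where "E = (\<integral>\<^sup>+\<omega>. epowr (total_variation (\<lambda>t. fv_part M F T X t \<omega>) T) p \<partial>M)"
  have cov: "mean_covariation M F T p L U \<le> ennreal (p powr p) * E"
    unfolding E_def using assms by (intro mean_covariation_le_fv_part)
  have L_le: "AE \<omega> in M. \<forall>t\<in>{0..T}. \<bar>max (L t \<omega>) 0\<bar> \<le> \<bar>X t \<omega>\<bar>"
    using assms(8) by eventually_elim fastforce
  have U_le: "AE \<omega> in M. \<forall>t\<in>{0..T}. \<bar>max (- U t \<omega>) 0\<bar> \<le> \<bar>X t \<omega>\<bar>"
    using assms(8) by eventually_elim fastforce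
  show ?thesis
  proof (intro conjI impI)
    assume "1 < p"
    define S where "S = Sp_norm M T p X"
    have "epowr (mean_covariation M F T p L U) (1 / p) \<le> epowr (ennreal (p powr p) * E) (1 / p)"
      using \<open>1 < p\<close> by (intro epowr_mono cov) auto
    also have "\<dots> \<le> ennreal p * epowr E (1 / p)"
      using \<open>1 < p\<close> by (intro epowr_mult_inverse) auto
    also have "\<dots> \<le> ennreal (max 2 p) * epowr E (1 / p)"
      by (intro mult_right_mono ennreal_leI) auto
    finally have "Sp_norm M T p (\<lambda>t \<omega>. max (L t \<omega>) 0) + Sp_norm M T p (\<lambda>t \<omega>. max (- U t \<omega>) 0)
        + epowr (mean_covariation M F T p L U) (1 / p) \<le> (S + S) + ennreal (max 2 p) * epowr E (1 / p)"
      unfolding S_def using \<open>1 < p\<close> L_le U_le by (intro add_mono Sp_norm_mono_AE) auto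
    \<comment> \<open>The two copies come from the parts of \<open>L\<close> and \<open>U\<close>;
      \<open>max 2 p\<close> dominates this 2 as well as the factor \<open>p\<close> of the
      variation term.\<close>
    also have "S + S = ennreal 2 * S"
      by (simp add: mult_2)
    also have "\<dots> \<le> ennreal (max 2 p) * S"
      by (intro mult_right_mono ennreal_leI) auto
    finally show "Sp_norm M T p (\<lambda>t \<omega>. max (L t \<omega>) 0) + Sp_norm M T p (\<lambda>t \<omega>. max (- U t \<omega>) 0)
        + epowr (mean_covariation M F T p L U) (1 / p) \<le> ennreal (max 2 p) * Hp_norm M F T p X"
      using \<open>1 < p\<close> by (simp add: Hp_norm_def Let_def E_def S_def distrib_left add_right_mono)
  next
    assume "p = 1"
    define S where "S = D1_norm M F T X"
    have "D1_norm M F T (\<lambda>t \<omega>. max (L t \<omega>) 0) + D1_norm M F T (\<lambda>t \<omega>. max (- U t \<omega>) 0)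
        + mean_covariation M F T 1 L U \<le> (S + S) + E"
      unfolding S_def using cov L_le U_le \<open>p = 1\<close> by (intro add_mono D1_norm_mono_AE) auto
    \<comment> \<open>For \<open>p = 1\<close> the variation enters with factor 1; it is doubled to
      form a multiple of the whole norm.\<close>
    also have "\<dots> \<le> (S + S) + (E + E)"
      by (intro add_left_mono) simp
    also have "\<dots> = 2 * Hp_norm M F T 1 X"
      using \<open>p = 1\<close> by (simp add: Hp_norm_def Let_def E_def S_def distrib_left mult_2 ac_simps)
    finally show "D1_norm M F T (\<lambda>t \<omega>. max (L t \<omega>) 0) + D1_norm M F T (\<lambda>t \<omega>. max (- U t \<omega>) 0)
        + mean_covariation M F T 1 L U \<le> 2 * Hp_norm M F T 1 X" .
  qed
qed

end
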